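(* Let $\mathcal{C}$ be a non-zero $A$-coring with ${}_A\mathcal{C}$ flat and let $M$ be a non-zero right $\mathcal{C}$-comodule that is intrinsically injective and self-cogenerator, such that the ring $\mathrm{E}_M^{\mathcal{C}}=\mathrm{End}^{\mathcal{C}}(M)^{op}$ is right Noetherian. Then $$\mathrm{Prad}(\mathrm{E}_M^{\mathcal{C}})=\mathrm{An}(\mathrm{CPcorad}(M))\quad\text{and}\quad \mathrm{CPcorad}(M)=\mathrm{Ke}(\mathrm{Prad}(\mathrm{E}_M^{\mathcal{C}})).$$
   Context: $R$ is a commutative ring with $1\neq 0$, $A$ is a unital $R$-algebra, $\mathcal{C}$ is an $A$-coring (a coalgebra in the monoidal category of $(A,A)$-bimodules), and comodules are right $\mathcal{C}$-comodules with $\mathcal{C}$-colinear maps. Since ${}_A\mathcal{C}$ is flat, $\mathbb{M}^{\mathcal{C}}$ is a Grothendieck category with kernels formed in right $A$-modules. $\mathrm{E}_M^{\mathcal{C}}$ has multiplication $(fg)(m)=g(f(m))$. For a ring $T$, $\mathrm{Prad}(T)$ is the prime radical (intersection of all prime ideals). For $K\subseteq M$ and $I\subseteq \mathrm{E}_M^{\mathcal{C}}$ put $\mathrm{An}(K)=\{f\in \mathrm{E}_M^{\mathcal{C}}: f(K)=0\}$ and $\mathrm{Ke}(I)=\bigcap_{f\in I}\mathrm{Ker}(f)$. $M$ is intrinsically injective if $\mathrm{An}(\mathrm{Ke}(I))=I$ for every finitely generated right ideal $I$ of $\mathrm{E}_M^{\mathcal{C}}$. $M$ is self-cogenerator if it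 cogenerates all its factor comodules, i.e. for every $\mathcal{C}$-subcomodule $K\subseteq M$ the intersection of the kernels of all $h\in\mathrm{Hom}^{\mathcal{C}}(M/K,M)$ is $0$. A subcomodule $X\subseteq M$ is fully invariant if $f(X)\subseteq X$ for all $f\in\mathrm{End}^{\mathcal{C}}(M)$. For subcomodules $X,Y\subseteq M$ let $(X:_M^{\mathcal{C}}Y):=\bigcap\{f^{-1}(Y): f\in \mathrm{End}^{\mathcal{C}}(M),\ f(X)=0\}$. A non-zero fully invariant subcomodule $K\subseteq M$ is fully $M$-coprime if for any fully invariant subcomodules $X,Y\subseteq M$ with $K\subseteq (X:_M^{\mathcal{C}}Y)$ one has $K\subseteq X$ or $K\subseteq Y$. The fully coprime coradical $\mathrm{CPcorad}(M)$ is the sum of all fully $M$-coprime subcomodules of $M$. *)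

theory Defs
  imports "HOL-Algebra.Free_Abelian_Groups" "HOL-Algebra.Ideal_Product" "HOL-Algebra.Module"
begin

section \<open>Algebras, right modules and bimodules\<close>

text \<open>
  Modules in HOL-Algebra are over commutative rings.  The records below follow the same pattern
  (an additive group is a ring record whose fields \<open>mult\<close> and \<open>one\<close> are ignored) for right
  modules and for bimodules over an arbitrary ring.
\<close>

record ('a, 'm) rmodule = "'m ring" +
  ract :: "'m \<Rightarrow> 'a \<Rightarrow> 'm"  (infixl \<open>\<lhd>\<index>\<close> 70)

record ('a, 'm) bimodule = "('a, 'm) rmodule" +
  lact :: "'a \<Rightarrow> 'm \<Rightarrow> 'm"  (infixr \<open>\<rhd>\<index>\<close> 70)

locale unital_algebra = scalar: module R A + A: ring A
  for R :: "('r, 'rx) ring_scheme" (structure)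
    and A :: "('r, 'a, 'ax) module_scheme" (structure) +
  assumes smult_mult_left: "\<lbrakk>r \<in> carrier R; a \<in> carrier A; b \<in> carrier A\<rbrakk> \<Longrightarrow>
      r \<odot>\<^bsub>A\<^esub> (a \<otimes>\<^bsub>A\<^esub> b) = (r \<odot>\<^bsub>A\<^esub> a) \<otimes>\<^bsub>A\<^esub> b"
    and smult_mult_right: "\<lbrakk>r \<in> carrier R; a \<in> carrier A; b \<in> carrier A\<rbrakk> \<Longrightarrow>
      r \<odot>\<^bsub>A\<^esub> (a \<otimes>\<^bsub>A\<^esub> b) = a \<otimes>\<^bsub>A\<^esub> (r \<odot>\<^bsub>A\<^esub> b)"

locale right_module = A: ring A + M: abelian_group M
  for A :: "('a, 'ax) ring_scheme" (structure)
    and M :: "('a, 'm, 'mx) rmodule_scheme" (structure) +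
  assumes ract_closed: "\<lbrakk>m \<in> carrier M; a \<in> carrier A\<rbrakk> \<Longrightarrow> m \<lhd>\<^bsub>M\<^esub> a \<in> carrier M"
    and ract_add_left: "\<lbrakk>m \<in> carrier M; n \<in> carrier M; a \<in> carrier A\<rbrakk> \<Longrightarrow>
      (m \<oplus>\<^bsub>M\<^esub> n) \<lhd>\<^bsub>M\<^esub> a = (m \<lhd>\<^bsub>M\<^esub> a) \<oplus>\<^bsub>M\<^esub> (n \<lhd>\<^bsub>M\<^esub> a)"
    and ract_add_right: "\<lbrakk>m \<in> carrier M; a \<in> carrier A; b \<in> carrier A\<rbrakk> \<Longrightarrow>
      m \<lhd>\<^bsub>M\<^esub> (a \<oplus>\<^bsub>A\<^esub> b) = (m \<lhd>\<^bsub>M\<^esub> a) \<oplus>\<^bsub>M\<^esub> (m \<lhd>\<^bsub>M\<^esub> b)"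
    and ract_assoc: "\<lbrakk>m \<in> carrier M; a \<in> carrier A; b \<in> carrier A\<rbrakk> \<Longrightarrow>
      m \<lhd>\<^bsub>M\<^esub> (a \<otimes>\<^bsub>A\<^esub> b) = (m \<lhd>\<^bsub>M\<^esub> a) \<lhd>\<^bsub>M\<^esub> b"
    and ract_one: "m \<in> carrier M \<Longrightarrow> m \<lhd>\<^bsub>M\<^esub> \<one>\<^bsub>A\<^esub> = m"

text \<open>
  As usual over an \<open>R\<close>-algebra, the two \<open>R\<close>-actions on an \<open>(A,A)\<close>-bimodule coincide
  (this is automatic for \<open>R = \<int>\<close>).
\<close>

locale alg_bimodule = algebra: unital_algebra R A + right: right_module A N
  for R :: "('r, 'rx) ring_scheme" (structure)
    and A :: "('r, 'a, 'ax) module_scheme" (structure)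
    and N :: "('a, 'n, 'nx) bimodule_scheme" (structure) +
  assumes lact_closed: "\<lbrakk>a \<in> carrier A; n \<in> carrier N\<rbrakk> \<Longrightarrow> a \<rhd>\<^bsub>N\<^esub> n \<in> carrier N"
    and lact_add_right: "\<lbrakk>a \<in> carrier A; m \<in> carrier N; n \<in> carrier N\<rbrakk> \<Longrightarrow>
      a \<rhd>\<^bsub>N\<^esub> (m \<oplus>\<^bsub>N\<^esub> n) = (a \<rhd>\<^bsub>N\<^esub> m) \<oplus>\<^bsub>N\<^esub> (a \<rhd>\<^bsub>N\<^esub> n)"
    and lact_add_left: "\<lbrakk>a \<in> carrier A; b \<in> carrier A; n \<in> carrier N\<rbrakk> \<Longrightarrow>
      (a \<oplus>\<^bsub>A\<^esub> b) \<rhd>\<^bsub>N\<^esub> n = (a \<rhd>\<^bsub>N\<^esub> n) \<oplus>\<^bsub>N\<^esub> (b \<rhd>\<^bsub>N\<^esub> n)"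
    and lact_assoc: "\<lbrakk>a \<in> carrier A; b \<in> carrier A; n \<in> carrier N\<rbrakk> \<Longrightarrow>
      (a \<otimes>\<^bsub>A\<^esub> b) \<rhd>\<^bsub>N\<^esub> n = a \<rhd>\<^bsub>N\<^esub> (b \<rhd>\<^bsub>N\<^esub> n)"
    and lact_one: "n \<in> carrier N \<Longrightarrow> \<one>\<^bsub>A\<^esub> \<rhd>\<^bsub>N\<^esub> n = n"
    and lact_ract: "\<lbrakk>a \<in> carrier A; n \<in> carrier N; b \<in> carrier A\<rbrakk> \<Longrightarrow>
      (a \<rhd>\<^bsub>N\<^esub> n) \<lhd>\<^bsub>N\<^esub> b = a \<rhd>\<^bsub>N\<^esub> (n \<lhd>\<^bsub>N\<^esub> b)"
    and scalars_central: "\<lbrakk>r \<in> carrier R; n \<in> carrier N\<rbrakk> \<Longrightarrow>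
      (r \<odot>\<^bsub>A\<^esub> \<one>\<^bsub>A\<^esub>) \<rhd>\<^bsub>N\<^esub> n = n \<lhd>\<^bsub>N\<^esub> (r \<odot>\<^bsub>A\<^esub> \<one>\<^bsub>A\<^esub>)"

definition rlinear ::
  "('a, 'ax) ring_scheme \<Rightarrow> ('a, 'm, 'mx) rmodule_scheme \<Rightarrow> ('a, 'n, 'nx) rmodule_scheme
     \<Rightarrow> ('m \<Rightarrow> 'n) \<Rightarrow> bool" where
  "rlinear A M N f \<longleftrightarrow> f \<in> hom (add_monoid M) (add_monoid N) \<and>
     (\<forall>m\<in>carrier M. \<forall>a\<in>carrier A. f (m \<lhd>\<^bsub>M\<^esub> a) = f m \<lhd>\<^bsub>N\<^esub> a)"


section \<open>Tensor products over a ring\<close>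

type_synonym ('m, 'n) tens = "('m \<times> 'n \<Rightarrow>\<^sub>0 int) set"

definition tensor_rels ::
  "('a, 'ax) ring_scheme \<Rightarrow> ('a, 'm, 'mx) rmodule_scheme \<Rightarrow> ('a, 'n, 'nx) bimodule_scheme
     \<Rightarrow> ('m \<times> 'n \<Rightarrow>\<^sub>0 int) set" where
  "tensor_rels A M N =
     {frag_of (m \<oplus>\<^bsub>M\<^esub> m', n) - frag_of (m, n) - frag_of (m', n) | m m' n.
        m \<in> carrier M \<and> m' \<in> carrier M \<and> n \<in> carrier N} \<union>
     {frag_of (m, n \<oplus>\<^bsub>N\<^esub> n') - frag_of (m, n) - frag_of (m, n') | m n n'.
        m \<in> carrier M \<and> n \<in> carrier N \<and> n' \<in> carrier N} \<union>
     {frag_of (m \<lhd>\<^bsub>M\<^esub> a, n) - frag_of (m, a \<rhd>\<^bsub>N\<^esub> n) | m a n.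
        m \<in> carrier M \<and> a \<in> carrier A \<and> n \<in> carrier N}"

definition tensor_sub ::
  "('a, 'ax) ring_scheme \<Rightarrow> ('a, 'm, 'mx) rmodule_scheme \<Rightarrow> ('a, 'n, 'nx) bimodule_scheme
     \<Rightarrow> ('m \<times> 'n \<Rightarrow>\<^sub>0 int) set" where
  "tensor_sub A M N =
     generate (free_Abelian_group (carrier M \<times> carrier N)) (tensor_rels A M N)"

definition tensor_group ::
  "('a, 'ax) ring_scheme \<Rightarrow> ('a, 'm, 'mx) rmodule_scheme \<Rightarrow> ('a, 'n, 'nx) bimodule_scheme
     \<Rightarrow> ('m, 'n) tens monoid" where
  "tensor_group A M N =
     free_Abelian_group (carrier M \<times> carrier N) Mod tensor_sub A M N"

definition pure_tensor ::
  "('a, 'ax) ring_scheme \<Rightarrow> ('a, 'm, 'mx) rmodule_scheme \<Rightarrow> ('a, 'n, 'nx) bimodule_scheme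
     \<Rightarrow> 'm \<Rightarrow> 'n \<Rightarrow> ('m, 'n) tens" where
  "pure_tensor A M N m n =
     tensor_sub A M N #>\<^bsub>free_Abelian_group (carrier M \<times> carrier N)\<^esub> frag_of (m, n)"

text \<open>
  The homomorphism induced by a balanced map \<open>b\<close> into a commutative group \<open>G\<close>
  (written with the operations of a monoid record).
\<close>

definition tensor_lift ::
  "('a, 'ax) ring_scheme \<Rightarrow> ('a, 'm, 'mx) rmodule_scheme \<Rightarrow> ('a, 'n, 'nx) bimodule_scheme
     \<Rightarrow> ('g, 'gx) monoid_scheme \<Rightarrow> ('m \<Rightarrow> 'n \<Rightarrow> 'g) \<Rightarrow> ('m, 'n) tens \<Rightarrow> 'g" where
  "tensor_lift A M N G b =
     (THE h. h \<in> hom (tensor_group A M N) G \<inter> extensional (carrier (tensor_group A M N)) \<and>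
        (\<forall>m\<in>carrier M. \<forall>n\<in>carrier N. h (pure_tensor A M N m n) = b m n))"

text \<open>The map \<open>f \<otimes> g : M \<otimes> N \<rightarrow> M' \<otimes> N'\<close>.\<close>

definition tensor_map ::
  "('a, 'ax) ring_scheme \<Rightarrow> ('a, 'm, 'mx) rmodule_scheme \<Rightarrow> ('a, 'n, 'nx) bimodule_scheme
     \<Rightarrow> ('a, 'p, 'px) rmodule_scheme \<Rightarrow> ('a, 'q, 'qx) bimodule_scheme
     \<Rightarrow> ('m \<Rightarrow> 'p) \<Rightarrow> ('n \<Rightarrow> 'q) \<Rightarrow> ('m, 'n) tens \<Rightarrow> ('p, 'q) tens" where
  "tensor_map A M N M' N' f g =
     tensor_lift A M N (tensor_group A M' N') (\<lambda>m n. pure_tensor A M' N' (f m) (g n))"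

definition tensor_rmod ::
  "('a, 'ax) ring_scheme \<Rightarrow> ('a, 'm, 'mx) rmodule_scheme \<Rightarrow> ('a, 'n, 'nx) bimodule_scheme
     \<Rightarrow> ('a, ('m, 'n) tens) rmodule" where
  "tensor_rmod A M N =
     \<lparr>carrier = carrier (tensor_group A M N), monoid.mult = undefined, monoid.one = undefined,
      ring.zero = \<one>\<^bsub>tensor_group A M N\<^esub>, ring.add = monoid.mult (tensor_group A M N),
      ract = (\<lambda>t a. tensor_map A M N M N (\<lambda>m. m) (\<lambda>n. n \<lhd>\<^bsub>N\<^esub> a) t)\<rparr>"

definition tensor_bimod ::
  "('a, 'ax) ring_scheme \<Rightarrow> ('a, 'm, 'mx) bimodule_scheme \<Rightarrow> ('a, 'n, 'nx) bimodule_scheme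
     \<Rightarrow> ('a, ('m, 'n) tens) bimodule" where
  "tensor_bimod A M N =
     \<lparr>carrier = carrier (tensor_group A M N), monoid.mult = undefined, monoid.one = undefined,
      ring.zero = \<one>\<^bsub>tensor_group A M N\<^esub>, ring.add = monoid.mult (tensor_group A M N),
      ract = (\<lambda>t a. tensor_map A M N M N (\<lambda>m. m) (\<lambda>n. n \<lhd>\<^bsub>N\<^esub> a) t),
      lact = (\<lambda>a t. tensor_map A M N M N (\<lambda>m. a \<rhd>\<^bsub>M\<^esub> m) (\<lambda>n. n) t)\<rparr>"

text \<open>The canonical map \<open>(M \<otimes> N) \<otimes> P \<rightarrow> M \<otimes> (N \<otimes> P)\<close>, \<open>(m \<otimes> n) \<otimes> p \<mapsto> m \<otimes> (n \<otimes> p)\<close>.\<close>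

definition tensor_assoc ::
  "('a, 'ax) ring_scheme \<Rightarrow> ('a, 'm, 'mx) rmodule_scheme \<Rightarrow> ('a, 'n, 'nx) bimodule_scheme
     \<Rightarrow> ('a, 'p, 'px) bimodule_scheme
     \<Rightarrow> (('m, 'n) tens, 'p) tens \<Rightarrow> ('m, ('n, 'p) tens) tens" where
  "tensor_assoc A M N P =
     tensor_lift A (tensor_rmod A M N) P (tensor_group A M (tensor_bimod A N P))
       (\<lambda>t p. tensor_lift A M N (tensor_group A M (tensor_bimod A N P))
          (\<lambda>m n. pure_tensor A M (tensor_bimod A N P) m (pure_tensor A N P n p)) t)"

text \<open>
  \<open>N\<close> is flat as a left \<open>A\<close>-module: \<open>- \<otimes> N\<close> preserves injectivity of right \<open>A\<close>-linear maps.
  A definition in HOL cannot quantify over types, so the test modules \<open>X\<close>, \<open>Y\<close> are those whose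
  carrier lies in the type \<open>'u\<close>.  By the ideal criterion (injectivity of \<open>I \<otimes> N \<rightarrow> A \<otimes> N\<close> for
  right ideals \<open>I\<close> of \<open>A\<close>) the instance where \<open>'u\<close> is the element type of \<open>A\<close> is already
  equivalent to flatness, and it implies all other instances.
\<close>

definition flat_left ::
  "'u itself \<Rightarrow> ('a, 'ax) ring_scheme \<Rightarrow> ('a, 'n, 'nx) bimodule_scheme \<Rightarrow> bool" where
  "flat_left (_ :: 'u itself) A N \<longleftrightarrow>
     (\<forall>(X :: ('a, 'u) rmodule) (Y :: ('a, 'u) rmodule) f.
        right_module A X \<and> right_module A Y \<and> rlinear A X Y f \<and> inj_on f (carrier X) \<longrightarrow>
        inj_on (tensor_map A X N Y N f (\<lambda>n. n)) (carrier (tensor_group A X N)))"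


section \<open>Corings and comodules\<close>

record ('a, 'c) coring = "('a, 'c) bimodule" +
  comult :: "'c \<Rightarrow> ('c, 'c) tens"
  counit :: "'c \<Rightarrow> 'a"

locale coring = bimodule: alg_bimodule R A C
  for R :: "('r, 'rx) ring_scheme" (structure)
    and A :: "('r, 'a, 'ax) module_scheme" (structure)
    and C :: "('a, 'c, 'cx) coring_scheme" (structure) +
  assumes comult_rlinear: "rlinear A C (tensor_bimod A C C) (comult C)"
    and comult_lact: "\<lbrakk>a \<in> carrier A; c \<in> carrier C\<rbrakk> \<Longrightarrow>
      comult C (a \<rhd>\<^bsub>C\<^esub> c) = a \<rhd>\<^bsub>tensor_bimod A C C\<^esub> comult C c"
    and counit_hom: "counit C \<in> hom (add_monoid C) (add_monoid A)"
    and counit_ract: "\<lbrakk>c \<in> carrier C; a \<in> carrier A\<rbrakk> \<Longrightarrow>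
      counit C (c \<lhd>\<^bsub>C\<^esub> a) = counit C c \<otimes>\<^bsub>A\<^esub> a"
    and counit_lact: "\<lbrakk>a \<in> carrier A; c \<in> carrier C\<rbrakk> \<Longrightarrow>
      counit C (a \<rhd>\<^bsub>C\<^esub> c) = a \<otimes>\<^bsub>A\<^esub> counit C c"
    and coassoc: "c \<in> carrier C \<Longrightarrow>
      tensor_assoc A C C C
        (tensor_map A C C (tensor_bimod A C C) C (comult C) (\<lambda>d. d) (comult C c)) =
      tensor_map A C C C (tensor_bimod A C C) (\<lambda>d. d) (comult C) (comult C c)"
    and counit_left: "c \<in> carrier C \<Longrightarrow>
      tensor_lift A C C (add_monoid C) (\<lambda>d e. counit C d \<rhd>\<^bsub>C\<^esub> e) (comult C c) = c"
    and counit_right: "c \<in> carrier C \<Longrightarrow>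
      tensor_lift A C C (add_monoid C) (\<lambda>d e. d \<lhd>\<^bsub>C\<^esub> counit C e) (comult C c) = c"

record ('a, 'm, 'c) comodule = "('a, 'm) rmodule" +
  coact :: "'m \<Rightarrow> ('m, 'c) tens"

locale right_comodule = right: right_module A M
  for A :: "('a, 'ax) ring_scheme" (structure)
    and C :: "('a, 'c, 'cx) coring_scheme" (structure)
    and M :: "('a, 'm, 'c, 'mx) comodule_scheme" (structure) +
  assumes coact_rlinear: "rlinear A M (tensor_rmod A M C) (coact M)"
    and coact_coassoc: "m \<in> carrier M \<Longrightarrow>
      tensor_assoc A M C C
        (tensor_map A M C (tensor_rmod A M C) C (coact M) (\<lambda>d. d) (coact M m)) =
      tensor_map A M C M (tensor_bimod A C C) (\<lambda>n. n) (comult C) (coact M m)"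
    and coact_counit: "m \<in> carrier M \<Longrightarrow>
      tensor_lift A M C (add_monoid M) (\<lambda>n d. n \<lhd>\<^bsub>M\<^esub> counit C d) (coact M m) = m"

text \<open>
  Homomorphisms are extensional functions, so that equality of homomorphisms is equality in HOL.
\<close>

definition comodule_hom ::
  "('a, 'ax) ring_scheme \<Rightarrow> ('a, 'c, 'cx) coring_scheme \<Rightarrow> ('a, 'm, 'c, 'mx) comodule_scheme
     \<Rightarrow> ('a, 'n, 'c, 'nx) comodule_scheme \<Rightarrow> ('m \<Rightarrow> 'n) set" where
  "comodule_hom A C M N =
     {f \<in> extensional (carrier M). rlinear A M N f \<and>
        (\<forall>m\<in>carrier M. coact N (f m) = tensor_map A M C N C f (\<lambda>c. c) (coact M m))}"

definition subcomodule ::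
  "('a, 'ax) ring_scheme \<Rightarrow> ('a, 'c, 'cx) coring_scheme \<Rightarrow> ('a, 'm, 'c, 'mx) comodule_scheme
     \<Rightarrow> 'm set \<Rightarrow> bool" where
  "subcomodule A C M K \<longleftrightarrow> K \<subseteq> carrier M \<and>
     (\<exists>\<rho>. right_comodule A C (M\<lparr>carrier := K, coact := \<rho>\<rparr>) \<and>
          (\<lambda>k\<in>K. k) \<in> comodule_hom A C (M\<lparr>carrier := K, coact := \<rho>\<rparr>) M)"

text \<open>
  The factor module \<open>M/K\<close> and the factor comodule, whose coaction is the one making the
  canonical projection \<open>M \<rightarrow> M/K\<close> colinear.
\<close>

definition factor_rmodule ::
  "('a, 'm, 'mx) rmodule_scheme \<Rightarrow> 'm set \<Rightarrow> ('a, 'm set) rmodule" where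
  "factor_rmodule M K =
     \<lparr>carrier = a_rcosets\<^bsub>M\<^esub> K, monoid.mult = undefined, monoid.one = undefined,
      ring.zero = K, ring.add = set_add M,
      ract = (\<lambda>X a. \<Union>x\<in>X. K +>\<^bsub>M\<^esub> (x \<lhd>\<^bsub>M\<^esub> a))\<rparr>"

definition factor_comodule ::
  "('a, 'ax) ring_scheme \<Rightarrow> ('a, 'c, 'cx) coring_scheme \<Rightarrow> ('a, 'm, 'c, 'mx) comodule_scheme
     \<Rightarrow> 'm set \<Rightarrow> ('a, 'm set, 'c) comodule" where
  "factor_comodule A C M K =
     (let Q = factor_rmodule M K in
      \<lparr>carrier = carrier Q, monoid.mult = monoid.mult Q, monoid.one = monoid.one Q,
       ring.zero = ring.zero Q, ring.add = ring.add Q, ract = ract Q,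
       coact = (\<lambda>X. THE t. \<forall>x\<in>X.
         t = tensor_map A M C Q C (\<lambda>m. K +>\<^bsub>M\<^esub> m) (\<lambda>c. c) (coact M x))\<rparr>)"


section \<open>Noncommutative rings: right ideals, right Noetherian rings, prime radical\<close>

definition right_ideal :: "('t, 'tx) ring_scheme \<Rightarrow> 't set \<Rightarrow> bool" where
  "right_ideal T I \<longleftrightarrow> additive_subgroup I T \<and> (\<forall>x\<in>I. \<forall>t\<in>carrier T. x \<otimes>\<^bsub>T\<^esub> t \<in> I)"

definition gen_right_ideal :: "('t, 'tx) ring_scheme \<Rightarrow> 't set \<Rightarrow> 't set" where
  "gen_right_ideal T F = \<Inter>{I. right_ideal T I \<and> F \<subseteq> I}"

definition fg_right_ideal :: "('t, 'tx) ring_scheme \<Rightarrow> 't set \<Rightarrow> bool" where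
  "fg_right_ideal T I \<longleftrightarrow>
     right_ideal T I \<and> (\<exists>F. finite F \<and> F \<subseteq> carrier T \<and> I = gen_right_ideal T F)"

definition right_noetherian :: "('t, 'tx) ring_scheme \<Rightarrow> bool" where
  "right_noetherian T \<longleftrightarrow> (\<forall>I. right_ideal T I \<longrightarrow> fg_right_ideal T I)"

text \<open>
  The locale \<open>primeideal\<close> of HOL-Algebra is the elementwise notion for commutative rings; here the
  ideal-theoretic notion for arbitrary rings is meant.
\<close>

definition prime_ideal :: "('t, 'tx) ring_scheme \<Rightarrow> 't set \<Rightarrow> bool" where
  "prime_ideal T P \<longleftrightarrow> ideal P T \<and> P \<noteq> carrier T \<and>
     (\<forall>I J. ideal I T \<and> ideal J T \<and> ideal_prod T I J \<subseteq> P \<longrightarrow> I \<subseteq> P \<or> J \<subseteq> P)"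

definition Prad :: "('t, 'tx) ring_scheme \<Rightarrow> 't set" where
  "Prad T = carrier T \<inter> \<Inter>{P. prime_ideal T P}"


section \<open>The endomorphism ring and fully coprime subcomodules\<close>

text \<open>The ring \<open>E = End(M)\<^sup>o\<^sup>p\<close>: its multiplication is \<open>(f g)(m) = g (f m)\<close>.\<close>

definition endo_ring ::
  "('a, 'ax) ring_scheme \<Rightarrow> ('a, 'c, 'cx) coring_scheme \<Rightarrow> ('a, 'm, 'c, 'mx) comodule_scheme
     \<Rightarrow> ('m \<Rightarrow> 'm) ring" where
  "endo_ring A C M =
     \<lparr>carrier = comodule_hom A C M M,
      monoid.mult = (\<lambda>f g. \<lambda>m\<in>carrier M. g (f m)),
      monoid.one = (\<lambda>m\<in>carrier M. m),
      ring.zero = (\<lambda>m\<in>carrier M. \<zero>\<^bsub>M\<^esub>),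
      ring.add = (\<lambda>f g. \<lambda>m\<in>carrier M. f m \<oplus>\<^bsub>M\<^esub> g m)\<rparr>"

definition An ::
  "('a, 'ax) ring_scheme \<Rightarrow> ('a, 'c, 'cx) coring_scheme \<Rightarrow> ('a, 'm, 'c, 'mx) comodule_scheme
     \<Rightarrow> 'm set \<Rightarrow> ('m \<Rightarrow> 'm) set" where
  "An A C M K = {f \<in> carrier (endo_ring A C M). \<forall>k\<in>K. f k = \<zero>\<^bsub>M\<^esub>}"

definition Ke :: "('a, 'm, 'c, 'mx) comodule_scheme \<Rightarrow> ('m \<Rightarrow> 'm) set \<Rightarrow> 'm set" where
  "Ke M I = {m \<in> carrier M. \<forall>f\<in>I. f m = \<zero>\<^bsub>M\<^esub>}"

definition intrinsically_injective ::
  "('a, 'ax) ring_scheme \<Rightarrow> ('a, 'c, 'cx) coring_scheme \<Rightarrow> ('a, 'm, 'c, 'mx) comodule_scheme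
     \<Rightarrow> bool" where
  "intrinsically_injective A C M \<longleftrightarrow>
     (\<forall>I. fg_right_ideal (endo_ring A C M) I \<longrightarrow> An A C M (Ke M I) = I)"

definition self_cogenerator ::
  "('a, 'ax) ring_scheme \<Rightarrow> ('a, 'c, 'cx) coring_scheme \<Rightarrow> ('a, 'm, 'c, 'mx) comodule_scheme
     \<Rightarrow> bool" where
  "self_cogenerator A C M \<longleftrightarrow>
     (\<forall>K. subcomodule A C M K \<longrightarrow>
        {X \<in> carrier (factor_comodule A C M K).
           \<forall>h\<in>comodule_hom A C (factor_comodule A C M K) M. h X = \<zero>\<^bsub>M\<^esub>} =
        {\<zero>\<^bsub>factor_comodule A C M K\<^esub>})"

definition fully_invariant ::
  "('a, 'ax) ring_scheme \<Rightarrow> ('a, 'c, 'cx) coring_scheme \<Rightarrow> ('a, 'm, 'c, 'mx) comodule_scheme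
     \<Rightarrow> 'm set \<Rightarrow> bool" where
  "fully_invariant A C M X \<longleftrightarrow> subcomodule A C M X \<and> (\<forall>f\<in>comodule_hom A C M M. f ` X \<subseteq> X)"

definition colon ::
  "('a, 'ax) ring_scheme \<Rightarrow> ('a, 'c, 'cx) coring_scheme \<Rightarrow> ('a, 'm, 'c, 'mx) comodule_scheme
     \<Rightarrow> 'm set \<Rightarrow> 'm set \<Rightarrow> 'm set" where
  "colon A C M X Y =
     {m \<in> carrier M. \<forall>f\<in>comodule_hom A C M M. (\<forall>x\<in>X. f x = \<zero>\<^bsub>M\<^esub>) \<longrightarrow> f m \<in> Y}"

definition fully_coprime ::
  "('a, 'ax) ring_scheme \<Rightarrow> ('a, 'c, 'cx) coring_scheme \<Rightarrow> ('a, 'm, 'c, 'mx) comodule_scheme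
     \<Rightarrow> 'm set \<Rightarrow> bool" where
  "fully_coprime A C M K \<longleftrightarrow> fully_invariant A C M K \<and> K \<noteq> {\<zero>\<^bsub>M\<^esub>} \<and>
     (\<forall>X Y. fully_invariant A C M X \<and> fully_invariant A C M Y \<and> K \<subseteq> colon A C M X Y \<longrightarrow>
        K \<subseteq> X \<or> K \<subseteq> Y)"

text \<open>
  The sum of a family of submodules is the additive subgroup generated by its union; the empty
  family has sum \<open>0\<close>.
\<close>

definition CPcorad ::
  "('a, 'ax) ring_scheme \<Rightarrow> ('a, 'c, 'cx) coring_scheme \<Rightarrow> ('a, 'm, 'c, 'mx) comodule_scheme
     \<Rightarrow> 'm set" where
  "CPcorad A C M = generate (add_monoid M) (\<Union>{K. fully_coprime A C M K})"

end

theory Submission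
  imports Defs
begin

text \<open>
  For every right ideal \<open>I\<close> of \<open>E\<close> one has \<open>An (Ke I) = I\<close> (intrinsic injectivity, all right ideals
  being finitely generated), and for every subcomodule \<open>K\<close> one has \<open>Ke (An K) = K\<close> (compose maps
  \<open>M/K \<rightarrow> M\<close> with the projection).  Hence \<open>K \<mapsto> An K\<close> and \<open>P \<mapsto> Ke P\<close> are mutually inverse
  between fully coprime subcomodules and prime ideals: for \<open>I = An X\<close> and \<open>J = An Y\<close>, the condition
  \<open>K \<subseteq> (X : Y)\<close> says \<open>I J \<subseteq> An K\<close>.  Since \<open>An\<close> turns sums into intersections,
  \<open>Prad E = An (CPcorad M)\<close>, and applying \<open>Ke\<close> gives the second equality.  Flatness enters through
  a criterion: a submodule \<open>K\<close> is a subcomodule iff the coaction maps it into the image of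
  \<open>K \<otimes> C \<rightarrow> M \<otimes> C\<close>; this makes \<open>Ke I\<close> (for finitely generated \<open>I\<close>) and sums subcomodules.
\<close>

section \<open>Tensor products\<close>

text \<open>The obstacle is that a coaction takes values in M \<otimes> C, whose elements are cosets
  in a free abelian group. For a submodule K the cosets forming K \<otimes> C are different sets, so
  K \<otimes> C only maps to M \<otimes> C. Flatness tested on modules over the element type of M
  makes this map injective, hence a coaction on K can only be the lift of that of M. Its
  coassociativity lives in K \<otimes> (C \<otimes> C), and comparing it with that of M needs
  injectivity one tensor factor further, which is flatness over the element type of M \<otimes> C.
  Kernels need exactness besides injectivity: what f \<otimes> C kills must come from Ker f
  \<otimes> C. Finitely many generators reduce Ke I to finitely many kernels, each taken inside the
  previous one; this is a second use of the chain condition, besides An (Ke I) = I. The order of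
  multiplication in E makes the two primeness conditions match: g (f k) is the value at k of the
  product f g. The second equality applies Ke (An K) = K to K = CPcorad(M), so the sum itself has to
  be a subcomodule.\<close>

locale tensor_factors = M: abelian_group M + N: abelian_group N
  for A :: "('a, 'ax) ring_scheme"
    and M :: "('a, 'm, 'mx) rmodule_scheme"
    and N :: "('a, 'n, 'nx) bimodule_scheme" +
  assumes ract_closed: "\<lbrakk>m \<in> carrier M; a \<in> carrier A\<rbrakk> \<Longrightarrow> m \<lhd>\<^bsub>M\<^esub> a \<in> carrier M"
    and lact_closed: "\<lbrakk>a \<in> carrier A; n \<in> carrier N\<rbrakk> \<Longrightarrow> a \<rhd>\<^bsub>N\<^esub> n \<in> carrier N"

text \<open>The target \<open>G\<close> is written multiplicatively so that both a tensor group and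
  \<open>add_monoid\<close> of a module can take its place.\<close>

definition balanced ::
  "('a, 'ax) ring_scheme \<Rightarrow> ('a, 'm, 'mx) rmodule_scheme \<Rightarrow> ('a, 'n, 'nx) bimodule_scheme
     \<Rightarrow> ('g, 'gx) monoid_scheme \<Rightarrow> ('m \<Rightarrow> 'n \<Rightarrow> 'g) \<Rightarrow> bool" where
  "balanced A M N G b \<longleftrightarrow>
     (\<forall>m\<in>carrier M. \<forall>n\<in>carrier N. b m n \<in> carrier G) \<and>
     (\<forall>m\<in>carrier M. \<forall>m'\<in>carrier M. \<forall>n\<in>carrier N.
        b (m \<oplus>\<^bsub>M\<^esub> m') n = b m n \<otimes>\<^bsub>G\<^esub> b m' n) \<and>
     (\<forall>m\<in>carrier M. \<forall>n\<in>carrier N. \<forall>n'\<in>carrier N.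
        b m (n \<oplus>\<^bsub>N\<^esub> n') = b m n \<otimes>\<^bsub>G\<^esub> b m n') \<and>
     (\<forall>m\<in>carrier M. \<forall>a\<in>carrier A. \<forall>n\<in>carrier N. b (m \<lhd>\<^bsub>M\<^esub> a) n = b m (a \<rhd>\<^bsub>N\<^esub> n))"

lemma balancedI:
  assumes "\<And>m n. \<lbrakk>m \<in> carrier M; n \<in> carrier N\<rbrakk> \<Longrightarrow> b m n \<in> carrier G"
    and "\<And>m m' n. \<lbrakk>m \<in> carrier M; m' \<in> carrier M; n \<in> carrier N\<rbrakk> \<Longrightarrow>
      b (m \<oplus>\<^bsub>M\<^esub> m') n = b m n \<otimes>\<^bsub>G\<^esub> b m' n"
    and "\<And>m n n'. \<lbrakk>m \<in> carrier M; n \<in> carrier N; n' \<in> carrier N\<rbrakk> \<Longrightarrow>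
      b m (n \<oplus>\<^bsub>N\<^esub> n') = b m n \<otimes>\<^bsub>G\<^esub> b m n'"
    and "\<And>m a n. \<lbrakk>m \<in> carrier M; a \<in> carrier A; n \<in> carrier N\<rbrakk> \<Longrightarrow>
      b (m \<lhd>\<^bsub>M\<^esub> a) n = b m (a \<rhd>\<^bsub>N\<^esub> n)"
  shows "balanced A M N G b"
  using assms unfolding balanced_def by blast

lemma balancedD:
  assumes "balanced A M N G b"
  shows "\<And>m n. \<lbrakk>m \<in> carrier M; n \<in> carrier N\<rbrakk> \<Longrightarrow> b m n \<in> carrier G"
    and "\<And>m m' n. \<lbrakk>m \<in> carrier M; m' \<in> carrier M; n \<in> carrier N\<rbrakk> \<Longrightarrow>
      b (m \<oplus>\<^bsub>M\<^esub> m') n = b m n \<otimes>\<^bsub>G\<^esub> b m' n"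
    and "\<And>m n n'. \<lbrakk>m \<in> carrier M; n \<in> carrier N; n' \<in> carrier N\<rbrakk> \<Longrightarrow>
      b m (n \<oplus>\<^bsub>N\<^esub> n') = b m n \<otimes>\<^bsub>G\<^esub> b m n'"
    and "\<And>m a n. \<lbrakk>m \<in> carrier M; a \<in> carrier A; n \<in> carrier N\<rbrakk> \<Longrightarrow>
      b (m \<lhd>\<^bsub>M\<^esub> a) n = b m (a \<rhd>\<^bsub>N\<^esub> n)"
  using assms unfolding balanced_def by blast+

lemma hom_inv:
  assumes "h \<in> hom G H" "group G" "group H" "x \<in> carrier G"
  shows "h (inv\<^bsub>G\<^esub> x) = inv\<^bsub>H\<^esub> (h x)"
  using assms by (metis group_hom.hom_inv group_hom.intro group_hom_axioms.intro)

lemma hom_diff_one_iff: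
  assumes "h \<in> hom G H" "group G" "group H" "x \<in> carrier G" "y \<in> carrier G"
  shows "h (x \<otimes>\<^bsub>G\<^esub> inv\<^bsub>G\<^esub> y) = \<one>\<^bsub>H\<^esub> \<longleftrightarrow> h x = h y"
proof -
  interpret G: group G by fact
  interpret H: group H by fact
  have c: "h x \<in> carrier H" "h y \<in> carrier H" using assms by (auto simp: hom_def)
  have "h (x \<otimes>\<^bsub>G\<^esub> inv\<^bsub>G\<^esub> y) = h x \<otimes>\<^bsub>H\<^esub> inv\<^bsub>H\<^esub> (h y)"
    using assms by (simp add: hom_mult[OF assms(1)] hom_inv)
  with c show ?thesis by (metis H.inv_equality H.inv_inv H.r_inv H.inv_closed)
qed

lemma inj_on_hom_iff:
  assumes "h \<in> hom G H" "group G" "group H"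
  shows "inj_on h (carrier G) \<longleftrightarrow> (\<forall>x\<in>carrier G. h x = \<one>\<^bsub>H\<^esub> \<longrightarrow> x = \<one>\<^bsub>G\<^esub>)"
proof -
  interpret group_hom G H h
    using assms by (simp add: group_hom_axioms.intro group_hom.intro)
  show ?thesis using inj_on_one_iff by auto
qed

section \<open>Universal property of the tensor product over a ring\<close>

context tensor_factors
begin

abbreviation "T \<equiv> tensor_group A M N"
abbreviation "F \<equiv> free_Abelian_group (carrier M \<times> carrier N)"

lemma tensor_rels_subset: "tensor_rels A M N \<subseteq> carrier F"
proof -
  have d: "Poly_Mapping.keys (a - b) \<subseteq> carrier M \<times> carrier N"
    if "Poly_Mapping.keys a \<subseteq> carrier M \<times> carrier N" "Poly_Mapping.keys b \<subseteq> carrier M \<times> carrier N"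
    for a b :: "'m \<times> 'n \<Rightarrow>\<^sub>0 int"
    using that keys_diff[of a b] by blast
  show ?thesis
  proof
    fix x assume "x \<in> tensor_rels A M N"
    then have "Poly_Mapping.keys x \<subseteq> carrier M \<times> carrier N"
      unfolding tensor_rels_def
      by (elim UnE CollectE exE conjE; simp only:; intro d; simp add: ract_closed lact_closed)
    then show "x \<in> carrier F" by simp
  qed
qed

lemma tensor_sub_subgroup: "subgroup (tensor_sub A M N) F"
  unfolding tensor_sub_def
  by (rule group.generate_is_subgroup[OF group_free_Abelian_group tensor_rels_subset])

lemma tensor_sub_normal: "tensor_sub A M N \<lhd> F"
  using comm_group.normal_iff_subgroup[OF abelian_free_Abelian_group] tensor_sub_subgroup by blast

lemma comm_group_tensor: "comm_group T"
  unfolding tensor_group_def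
  by (rule comm_group.abelian_FactGroup[OF abelian_free_Abelian_group tensor_sub_subgroup])

lemma group_tensor: "group T"
  using comm_group_tensor comm_group.axioms(2) by blast

lemma coset_hom: "(\<lambda>x. tensor_sub A M N #>\<^bsub>F\<^esub> x) \<in> hom F T"
  unfolding tensor_group_def by (rule normal.r_coset_hom_Mod[OF tensor_sub_normal])

lemma carrier_tensor: "carrier T = (\<lambda>x. tensor_sub A M N #>\<^bsub>F\<^esub> x) ` carrier F"
  unfolding tensor_group_def by (rule carrier_FactGroup)

lemma coset_eqI:
  assumes "x - y \<in> tensor_sub A M N" "x \<in> carrier F" "y \<in> carrier F"
  shows "tensor_sub A M N #>\<^bsub>F\<^esub> x = tensor_sub A M N #>\<^bsub>F\<^esub> y"
proof -
  have "x \<in> tensor_sub A M N #>\<^bsub>F\<^esub> y"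
    unfolding r_coset_def using assms by (auto intro!: bexI[of _ "x - y"])
  then show ?thesis
    using group.repr_independence[OF group_free_Abelian_group _ _ tensor_sub_subgroup]
      assms(3) by metis
qed

lemma pure_tensor_closed [simp]:
  "\<lbrakk>m \<in> carrier M; n \<in> carrier N\<rbrakk> \<Longrightarrow> pure_tensor A M N m n \<in> carrier T"
  unfolding pure_tensor_def carrier_tensor by auto

text \<open>Additivity in either variable is a relation of the same shape, one generator minus two
  others, so one argument serves both.\<close>

lemma tensor_relI:
  assumes "frag_of (m, n) - frag_of (m', n') - frag_of (m'', n'') \<in> tensor_rels A M N"
    and "m \<in> carrier M" "n \<in> carrier N" "m' \<in> carrier M" "n' \<in> carrier N"
      "m'' \<in> carrier M" "n'' \<in> carrier N"
  shows "pure_tensor A M N m n = pure_tensor A M N m' n' \<otimes>\<^bsub>T\<^esub> pure_tensor A M N m'' n''"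
proof -
  have c: "frag_of (m', n') \<in> carrier F" "frag_of (m'', n'') \<in> carrier F" "frag_of (m, n) \<in> carrier F"
    using assms by auto
  have c': "frag_of (m', n') + frag_of (m'', n'') \<in> carrier F"
    using group.subgroup_self c by (metis group_free_Abelian_group mult_free_Abelian_group subgroup_def)
  have "pure_tensor A M N m' n' \<otimes>\<^bsub>T\<^esub> pure_tensor A M N m'' n'' =
      tensor_sub A M N #>\<^bsub>F\<^esub> (frag_of (m', n') + frag_of (m'', n''))"
    unfolding pure_tensor_def using hom_mult[OF coset_hom c(1,2)] by simp
  also have "\<dots> = pure_tensor A M N m n" unfolding pure_tensor_def
    by (rule coset_eqI[symmetric, OF _ c(3) c'])
      (use assms(1) in \<open>auto simp: tensor_sub_def diff_diff_eq intro: generate.incl\<close>)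
  finally show ?thesis ..
qed

lemma balanced_pure_tensor: "balanced A M N T (pure_tensor A M N)"
proof (rule balancedI)
  fix m m' n assume "m \<in> carrier M" "m' \<in> carrier M" "n \<in> carrier N"
  then show "pure_tensor A M N (m \<oplus>\<^bsub>M\<^esub> m') n = pure_tensor A M N m n \<otimes>\<^bsub>T\<^esub> pure_tensor A M N m' n"
    by (intro tensor_relI) (auto simp: tensor_rels_def)
next
  fix m n n' assume "m \<in> carrier M" "n \<in> carrier N" "n' \<in> carrier N"
  then show "pure_tensor A M N m (n \<oplus>\<^bsub>N\<^esub> n') = pure_tensor A M N m n \<otimes>\<^bsub>T\<^esub> pure_tensor A M N m n'"
    by (intro tensor_relI) (auto simp: tensor_rels_def)
next
  fix m a n assume *: "m \<in> carrier M" "a \<in> carrier A" "n \<in> carrier N"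
  show "pure_tensor A M N (m \<lhd>\<^bsub>M\<^esub> a) n = pure_tensor A M N m (a \<rhd>\<^bsub>N\<^esub> n)"
    unfolding pure_tensor_def
    by (rule coset_eqI) (use * ract_closed lact_closed in \<open>auto simp: tensor_sub_def tensor_rels_def intro!: generate.incl\<close>)
qed simp

lemmas pure_tensor_add_left = balancedD(2)[OF balanced_pure_tensor]
  and pure_tensor_add_right = balancedD(3)[OF balanced_pure_tensor]
  and pure_tensor_ract = balancedD(4)[OF balanced_pure_tensor]

text \<open>Induction on the free abelian group, read through the quotient map. Its closing step is
  the difference of two elements, hence the case \<open>diff\<close> in place of products and
  inverses separately.\<close>

lemma tensor_induct [consumes 1, case_names one pure diff]:
  assumes "t \<in> carrier T" "P \<one>\<^bsub>T\<^esub>"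
    and pure: "\<And>m n. \<lbrakk>m \<in> carrier M; n \<in> carrier N\<rbrakk> \<Longrightarrow> P (pure_tensor A M N m n)"
    and diff: "\<And>s t. \<lbrakk>s \<in> carrier T; t \<in> carrier T; P s; P t\<rbrakk> \<Longrightarrow> P (s \<otimes>\<^bsub>T\<^esub> inv\<^bsub>T\<^esub> t)"
  shows "P t"
proof -
  let ?q = "\<lambda>x. tensor_sub A M N #>\<^bsub>F\<^esub> x"
  interpret q: group_hom F T ?q
    using coset_hom group_tensor by (simp add: group_hom_axioms.intro group_hom.intro)
  obtain x where x: "Poly_Mapping.keys x \<subseteq> carrier M \<times> carrier N" "t = ?q x"
    using assms(1) carrier_tensor by auto
  have "P (?q x)"
  proof (rule free_Abelian_group_induct[where P = "\<lambda>x. P (?q x)", OF x(1)])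
    show "P (?q 0)" using q.hom_one assms(2) by simp
  next
    fix x y assume xy: "Poly_Mapping.keys x \<subseteq> carrier M \<times> carrier N"
      "Poly_Mapping.keys y \<subseteq> carrier M \<times> carrier N" "P (?q x)" "P (?q y)"
    have "?q (x - y) = ?q (x \<otimes>\<^bsub>F\<^esub> inv\<^bsub>F\<^esub> y)" using xy by simp
    also have "\<dots> = ?q x \<otimes>\<^bsub>T\<^esub> inv\<^bsub>T\<^esub> (?q y)"
      using xy by (metis carrier_free_Abelian_group_iff group.inv_closed group_free_Abelian_group
          q.hom_inv q.hom_mult)
    finally show "P (?q (x - y))"
      using xy diff q.hom_closed by (simp del: pure_tensor_closed)
  next
    fix z assume "z \<in> carrier M \<times> carrier N"
    then show "P (?q (frag_of z))" using pure by (cases z) (auto simp: pure_tensor_def)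
  qed
  then show ?thesis using x by simp
qed

text \<open>Pure tensors generate, so homomorphisms are determined by them. Later identities between
  maps on tensor products are checked on pure tensors by this rule. Extensionality is not assumed of
  \<open>h\<close> and \<open>h'\<close>, so the equality holds on the carrier only.\<close>

lemma tensor_hom_eqI:
  assumes "h \<in> hom T G" "h' \<in> hom T G" "group G"
    and "\<And>m n. \<lbrakk>m \<in> carrier M; n \<in> carrier N\<rbrakk> \<Longrightarrow>
      h (pure_tensor A M N m n) = h' (pure_tensor A M N m n)"
    and "t \<in> carrier T"
  shows "h t = h' t"
  using assms(5)
proof (induction rule: tensor_induct)
  case one
  then show ?case using assms(1,2,3) group_tensor by (metis hom_one)
next
  case (diff s t)
  interpret group T by (rule group_tensor)
  show ?case using diff by (simp add: hom_mult[OF assms(1)] hom_mult[OF assms(2)] hom_inv[OF assms(1) group_tensor assms(3)]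
      hom_inv[OF assms(2) group_tensor assms(3)])
qed (use assms in auto)

lemma tensor_universal:
  assumes "comm_group G" "balanced A M N G b"
  shows "\<exists>h \<in> hom T G. \<forall>m\<in>carrier M. \<forall>n\<in>carrier N. h (pure_tensor A M N m n) = b m n"
proof -
  interpret G: comm_group G by fact
  have "(\<lambda>(m, n). b m n) ` (carrier M \<times> carrier N) \<subseteq> carrier G"
    using balancedD(1)[OF assms(2)] by auto
  then obtain h where h: "h \<in> hom F G"
    "\<And>x. x \<in> carrier M \<times> carrier N \<Longrightarrow> h (frag_of x) = (\<lambda>(m, n). b m n) x"
    by (rule G.free_Abelian_group_universal) blast
  interpret h: group_hom F G h
    using h by (simp add: group_hom_axioms.intro group_hom.intro)
  \<comment> \<open>A difference of elements with equal image is killed by \<open>h\<close>. This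
    serves the balancing relation directly, and through \<open>m3\<close> the two additivity
    relations.\<close>
  have m: "\<one>\<^bsub>G\<^esub> = h (x - y)" if "x \<in> carrier F" "y \<in> carrier F" "h x = h y" for x y
    using hom_diff_one_iff[OF h(1) group_free_Abelian_group G.is_group that(1,2)] that by simp
  have m3: "\<one>\<^bsub>G\<^esub> = h (frag_of x - frag_of y - frag_of z)"
    if "x \<in> carrier M \<times> carrier N" "y \<in> carrier M \<times> carrier N" "z \<in> carrier M \<times> carrier N"
      "h (frag_of x) = h (frag_of y) \<otimes>\<^bsub>G\<^esub> h (frag_of z)" for x y z
  proof -
    have "h (frag_of y \<otimes>\<^bsub>F\<^esub> frag_of z) = h (frag_of x)"
      using that by (subst h.hom_mult) auto
    moreover have "frag_of y \<otimes>\<^bsub>F\<^esub> frag_of z \<in> carrier F"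
      using that by (intro monoid.m_closed) (auto simp: group.is_monoid)
    ultimately show ?thesis using m[of "frag_of x" "frag_of y \<otimes>\<^bsub>F\<^esub> frag_of z"] that(1)
      by (simp add: diff_diff_eq)
  qed
  have "tensor_rels A M N \<subseteq> kernel F G h"
  proof
    fix x assume x: "x \<in> tensor_rels A M N"
    have "\<one>\<^bsub>G\<^esub> = h x"
      using x unfolding tensor_rels_def
      by (elim UnE CollectE exE conjE; simp only:)
        ((rule m3 m; simp add: h(2) balancedD[OF assms(2)] ract_closed lact_closed)+)
    then show "x \<in> kernel F G h"
      using subsetD[OF tensor_rels_subset x] by (simp add: kernel_def)
  qed
  then have "tensor_sub A M N \<subseteq> kernel F G h"
    unfolding tensor_sub_def
    by (metis group.generate_subgroup_incl group_free_Abelian_group h.subgroup_kernel)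
  then obtain g where g: "g \<in> hom (F Mod tensor_sub A M N) G"
    "\<And>x. x \<in> carrier F \<Longrightarrow> g (tensor_sub A M N #>\<^bsub>F\<^esub> x) = h x"
    using h.FactGroup_universal_kernel[OF tensor_sub_normal] by blast
  show ?thesis
    using g h(2) unfolding tensor_group_def pure_tensor_def by (auto intro!: bexI[of _ g])
qed

text \<open>The definite description is justified here: existence comes from the universal property
  after restriction to the carrier; uniqueness holds on the carrier because pure tensors generate,
  and outside it by extensionality.\<close>

lemma tensor_lift:
  assumes "comm_group G" "balanced A M N G b"
  shows "tensor_lift A M N G b \<in> hom T G \<inter> extensional (carrier T) \<and>
    (\<forall>m\<in>carrier M. \<forall>n\<in>carrier N. tensor_lift A M N G b (pure_tensor A M N m n) = b m n)"
proof -
  have gG: "group G" using assms(1) comm_group.axioms(2) by blast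
  obtain h where h: "h \<in> hom T G"
    "\<forall>m\<in>carrier M. \<forall>n\<in>carrier N. h (pure_tensor A M N m n) = b m n"
    using tensor_universal[OF assms] by blast
  have "restrict h (carrier T) \<in> hom T G"
    using h group.hom_restrict[OF group_tensor] by fastforce
  then have "restrict h (carrier T) \<in> hom T G \<inter> extensional (carrier T) \<and>
    (\<forall>m\<in>carrier M. \<forall>n\<in>carrier N. restrict h (carrier T) (pure_tensor A M N m n) = b m n)"
    using h(2) by simp
  moreover have "k = restrict h (carrier T)"
    if "k \<in> hom T G \<inter> extensional (carrier T) \<and>
      (\<forall>m\<in>carrier M. \<forall>n\<in>carrier N. k (pure_tensor A M N m n) = b m n)" for k
  proof (rule extensionalityI[of _ "carrier T"])
    show "k t = restrict h (carrier T) t" if "t \<in> carrier T" for t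
      using that \<open>k \<in> _ \<and> _\<close> h tensor_hom_eqI[of k G h t] gG by simp
  qed (use that in auto)
  ultimately show ?thesis
    unfolding tensor_lift_def by (rule theI)
qed

end


section \<open>Functoriality and additivity of the tensor product of maps\<close>

definition llinear ::
  "('a, 'ax) ring_scheme \<Rightarrow> ('a, 'm, 'mx) bimodule_scheme \<Rightarrow> ('a, 'n, 'nx) bimodule_scheme
     \<Rightarrow> ('m \<Rightarrow> 'n) \<Rightarrow> bool" where
  "llinear A M N g \<longleftrightarrow> g \<in> hom (add_monoid M) (add_monoid N) \<and>
     (\<forall>m\<in>carrier M. \<forall>a\<in>carrier A. g (a \<rhd>\<^bsub>M\<^esub> m) = a \<rhd>\<^bsub>N\<^esub> g m)"

lemma rlinearD:
  assumes "rlinear A M N f"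
  shows "\<And>x. x \<in> carrier M \<Longrightarrow> f x \<in> carrier N"
    and "\<And>x y. \<lbrakk>x \<in> carrier M; y \<in> carrier M\<rbrakk> \<Longrightarrow> f (x \<oplus>\<^bsub>M\<^esub> y) = f x \<oplus>\<^bsub>N\<^esub> f y"
    and "\<And>x a. \<lbrakk>x \<in> carrier M; a \<in> carrier A\<rbrakk> \<Longrightarrow> f (x \<lhd>\<^bsub>M\<^esub> a) = f x \<lhd>\<^bsub>N\<^esub> a"
  using assms by (auto simp: rlinear_def hom_def)

lemma rlinearI:
  assumes "\<And>x. x \<in> carrier M \<Longrightarrow> f x \<in> carrier N"
    and "\<And>x y. \<lbrakk>x \<in> carrier M; y \<in> carrier M\<rbrakk> \<Longrightarrow> f (x \<oplus>\<^bsub>M\<^esub> y) = f x \<oplus>\<^bsub>N\<^esub> f y"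
    and "\<And>x a. \<lbrakk>x \<in> carrier M; a \<in> carrier A\<rbrakk> \<Longrightarrow> f (x \<lhd>\<^bsub>M\<^esub> a) = f x \<lhd>\<^bsub>N\<^esub> a"
  shows "rlinear A M N f"
  using assms by (auto simp: rlinear_def hom_def)

lemma llinearD:
  assumes "llinear A M N f"
  shows "\<And>x. x \<in> carrier M \<Longrightarrow> f x \<in> carrier N"
    and "\<And>x y. \<lbrakk>x \<in> carrier M; y \<in> carrier M\<rbrakk> \<Longrightarrow> f (x \<oplus>\<^bsub>M\<^esub> y) = f x \<oplus>\<^bsub>N\<^esub> f y"
    and "\<And>x a. \<lbrakk>x \<in> carrier M; a \<in> carrier A\<rbrakk> \<Longrightarrow> f (a \<rhd>\<^bsub>M\<^esub> x) = a \<rhd>\<^bsub>N\<^esub> f x"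
  using assms by (auto simp: llinear_def hom_def)

lemma llinearI:
  assumes "\<And>x. x \<in> carrier M \<Longrightarrow> f x \<in> carrier N"
    and "\<And>x y. \<lbrakk>x \<in> carrier M; y \<in> carrier M\<rbrakk> \<Longrightarrow> f (x \<oplus>\<^bsub>M\<^esub> y) = f x \<oplus>\<^bsub>N\<^esub> f y"
    and "\<And>x a. \<lbrakk>x \<in> carrier M; a \<in> carrier A\<rbrakk> \<Longrightarrow> f (a \<rhd>\<^bsub>M\<^esub> x) = a \<rhd>\<^bsub>N\<^esub> f x"
  shows "llinear A M N f"
  using assms by (auto simp: llinear_def hom_def)

lemma rlinear_id [simp]: "rlinear A M M (\<lambda>x. x)"
  by (auto intro: rlinearI)

lemma llinear_id [simp]: "llinear A M M (\<lambda>x. x)"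
  by (auto intro: llinearI)

lemma rlinear_comp:
  "\<lbrakk>rlinear A M N f; rlinear A N P g\<rbrakk> \<Longrightarrow> rlinear A M P (\<lambda>x. g (f x))"
  by (intro rlinearI) (simp_all add: rlinearD)

lemma llinear_comp:
  "\<lbrakk>llinear A M N f; llinear A N P g\<rbrakk> \<Longrightarrow> llinear A M P (\<lambda>x. g (f x))"
  by (intro llinearI) (simp_all add: llinearD)

lemma rlinear_zero_minus:
  assumes "rlinear A M N f" "abelian_group M" "abelian_group N"
  shows "f \<zero>\<^bsub>M\<^esub> = \<zero>\<^bsub>N\<^esub>"
    and "x \<in> carrier M \<Longrightarrow> f (\<ominus>\<^bsub>M\<^esub> x) = \<ominus>\<^bsub>N\<^esub> f x"
    and "\<lbrakk>x \<in> carrier M; y \<in> carrier M\<rbrakk> \<Longrightarrow> f (x \<ominus>\<^bsub>M\<^esub> y) = f x \<ominus>\<^bsub>N\<^esub> f y"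
proof -
  interpret M: abelian_group M by fact
  interpret N: abelian_group N by fact
  interpret group_hom "add_monoid M" "add_monoid N" f
    using assms(1) M.a_group N.a_group
    by (auto simp: rlinear_def intro!: group_hom.intro group_hom_axioms.intro)
  show "f \<zero>\<^bsub>M\<^esub> = \<zero>\<^bsub>N\<^esub>" using hom_one by simp
  show m: "f (\<ominus>\<^bsub>M\<^esub> x) = \<ominus>\<^bsub>N\<^esub> f x" if "x \<in> carrier M" for x
    using hom_inv[of x] that unfolding a_inv_def by simp
  show "f (x \<ominus>\<^bsub>M\<^esub> y) = f x \<ominus>\<^bsub>N\<^esub> f y" if "x \<in> carrier M" "y \<in> carrier M"
    using that m by (simp add: a_minus_def rlinearD(2)[OF assms(1)])
qed

lemma tensor_map_hom:
  assumes "tensor_factors A M N" "tensor_factors A M' N'" "rlinear A M M' f" "llinear A N N' g"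
  shows "tensor_map A M N M' N' f g \<in> hom (tensor_group A M N) (tensor_group A M' N')"
    and tensor_map_pure: "\<lbrakk>m \<in> carrier M; n \<in> carrier N\<rbrakk> \<Longrightarrow>
      tensor_map A M N M' N' f g (pure_tensor A M N m n) = pure_tensor A M' N' (f m) (g n)"
proof -
  interpret T: tensor_factors A M N by fact
  interpret T': tensor_factors A M' N' by fact
  note [simp] = rlinearD[OF assms(3)] llinearD[OF assms(4)]
  have b: "balanced A M N (tensor_group A M' N') (\<lambda>m n. pure_tensor A M' N' (f m) (g n))"
    by (rule balancedI)
      (simp_all add: T'.pure_tensor_add_left T'.pure_tensor_add_right T'.pure_tensor_ract)
  note l = T.tensor_lift[OF T'.comm_group_tensor b, folded tensor_map_def]
  show "tensor_map A M N M' N' f g \<in> hom (tensor_group A M N) (tensor_group A M' N')"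
    "\<lbrakk>m \<in> carrier M; n \<in> carrier N\<rbrakk> \<Longrightarrow>
      tensor_map A M N M' N' f g (pure_tensor A M N m n) = pure_tensor A M' N' (f m) (g n)"
    using l by auto
qed

lemma tensor_map_closed:
  assumes "tensor_factors A M N" "tensor_factors A M' N'" "rlinear A M M' f" "llinear A N N' g"
    and "t \<in> carrier (tensor_group A M N)"
  shows "tensor_map A M N M' N' f g t \<in> carrier (tensor_group A M' N')"
  using tensor_map_hom(1)[OF assms(1-4)] assms(5) by (auto simp: hom_def)

text \<open>The description inside \<open>tensor_lift\<close> evaluates the balanced map on the
  carriers only, so both sides are the same description. This allows rewriting under
  \<open>tensor_map\<close> with facts valid only on the carriers.\<close>

lemma tensor_map_cong:
  assumes "\<And>m. m \<in> carrier M \<Longrightarrow> f m = f' m" "\<And>n. n \<in> carrier N \<Longrightarrow> g n = g' n"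
  shows "tensor_map A M N M' N' f g = tensor_map A M N M' N' f' g'"
  unfolding tensor_map_def tensor_lift_def by (simp add: assms)

lemma hom_comp:
  "\<lbrakk>f \<in> hom G H; g \<in> hom H K\<rbrakk> \<Longrightarrow> (\<lambda>x. g (f x)) \<in> hom G K"
  by (auto simp: hom_def Pi_def)

lemma hom_mult_fun:
  assumes "f \<in> hom G H" "g \<in> hom G H" "comm_group H"
  shows "(\<lambda>x. f x \<otimes>\<^bsub>H\<^esub> g x) \<in> hom G H"
proof -
  interpret H: comm_group H by fact
  have c: "\<And>x. x \<in> carrier G \<Longrightarrow> f x \<in> carrier H \<and> g x \<in> carrier H"
    using assms by (auto simp: hom_def)
  show ?thesis
    by (rule homI) (use c in \<open>simp_all add: hom_mult[OF assms(1)] hom_mult[OF assms(2)] H.m_ac\<close>)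
qed

lemma tensor_map_comp:
  assumes "tensor_factors A M N" "tensor_factors A M' N'" "tensor_factors A M'' N''"
    and "rlinear A M M' f" "llinear A N N' g" "rlinear A M' M'' f'" "llinear A N' N'' g'"
    and "t \<in> carrier (tensor_group A M N)"
  shows "tensor_map A M' N' M'' N'' f' g' (tensor_map A M N M' N' f g t) =
    tensor_map A M N M'' N'' (\<lambda>x. f' (f x)) (\<lambda>x. g' (g x)) t"
proof -
  interpret T: tensor_factors A M N by fact
  interpret T'': tensor_factors A M'' N'' by fact
  show ?thesis
    by (rule T.tensor_hom_eqI[OF hom_comp[OF tensor_map_hom(1) tensor_map_hom(1)] tensor_map_hom(1)])
      (use assms in \<open>simp_all add: T''.group_tensor tensor_map_pure rlinear_comp llinear_comp rlinearD
        llinearD\<close>)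
qed

lemma tensor_map_id:
  assumes "tensor_factors A M N" "t \<in> carrier (tensor_group A M N)"
  shows "tensor_map A M N M N (\<lambda>x. x) (\<lambda>x. x) t = t"
proof -
  interpret T: tensor_factors A M N by fact
  have i: "(\<lambda>x. x) \<in> hom (tensor_group A M N) (tensor_group A M N)" by (auto simp: hom_def)
  show ?thesis
    by (rule T.tensor_hom_eqI[OF tensor_map_hom(1) i])
      (use assms in \<open>simp_all add: T.group_tensor tensor_map_pure\<close>)
qed

lemma rlinear_add:
  assumes "rlinear A M N f" "rlinear A M N g" "right_module A N"
  shows "rlinear A M N (\<lambda>x. f x \<oplus>\<^bsub>N\<^esub> g x)"
proof -
  interpret N: right_module A N by fact
  show ?thesis
    by (rule rlinearI)
      (simp_all add: rlinearD[OF assms(1)] rlinearD[OF assms(2)] N.M.a_ac N.ract_add_left)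
qed

lemma tensor_map_add_left:
  assumes "tensor_factors A M N" "tensor_factors A M' N'" "right_module A M'"
    and "rlinear A M M' f" "rlinear A M M' f'" "llinear A N N' g"
    and "t \<in> carrier (tensor_group A M N)"
  shows "tensor_map A M N M' N' (\<lambda>x. f x \<oplus>\<^bsub>M'\<^esub> f' x) g t =
    tensor_map A M N M' N' f g t \<otimes>\<^bsub>tensor_group A M' N'\<^esub> tensor_map A M N M' N' f' g t"
proof -
  interpret T: tensor_factors A M N by fact
  interpret T': tensor_factors A M' N' by fact
  show ?thesis
    by (rule T.tensor_hom_eqI[OF tensor_map_hom(1) hom_mult_fun[OF tensor_map_hom(1) tensor_map_hom(1)]])
      (use assms in \<open>simp_all add: T'.comm_group_tensor T'.group_tensor tensor_map_pure rlinear_add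
        T'.pure_tensor_add_left rlinearD llinearD\<close>)
qed

text \<open>Left linearity of the sum is an assumption because \<open>tensor_factors\<close> does
  not contain additivity of the left action on N'. On the other side,
  \<open>right_module A M'\<close> supplies it through \<open>rlinear_add\<close>.\<close>

lemma tensor_map_add_right:
  assumes "tensor_factors A M N" "tensor_factors A M' N'"
    and "rlinear A M M' f" "llinear A N N' g" "llinear A N N' g'"
    "llinear A N N' (\<lambda>x. g x \<oplus>\<^bsub>N'\<^esub> g' x)"
    and "t \<in> carrier (tensor_group A M N)"
  shows "tensor_map A M N M' N' f (\<lambda>x. g x \<oplus>\<^bsub>N'\<^esub> g' x) t =
    tensor_map A M N M' N' f g t \<otimes>\<^bsub>tensor_group A M' N'\<^esub> tensor_map A M N M' N' f g' t"
proof -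
  interpret T: tensor_factors A M N by fact
  interpret T': tensor_factors A M' N' by fact
  show ?thesis
    by (rule T.tensor_hom_eqI[OF tensor_map_hom(1) hom_mult_fun[OF tensor_map_hom(1) tensor_map_hom(1)]])
      (use assms in \<open>simp_all add: T'.comm_group_tensor T'.group_tensor tensor_map_pure
        T'.pure_tensor_add_right rlinearD llinearD\<close>)
qed

text \<open>Writing 0 = 0 + 0 makes the value equal to its own square, and the only such element of
  a group is the unit.\<close>

lemma tensor_map_zero:
  assumes "tensor_factors A M N" "tensor_factors A M' N'" "right_module A M'" "llinear A N N' g"
    and "t \<in> carrier (tensor_group A M N)"
  shows "tensor_map A M N M' N' (\<lambda>x. \<zero>\<^bsub>M'\<^esub>) g t = \<one>\<^bsub>tensor_group A M' N'\<^esub>"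
proof -
  interpret T': tensor_factors A M' N' by fact
  interpret M': right_module A M' by fact
  interpret G: group "tensor_group A M' N'" by (rule T'.group_tensor)
  have "\<zero>\<^bsub>M'\<^esub> \<lhd>\<^bsub>M'\<^esub> a = \<zero>\<^bsub>M'\<^esub>" if "a \<in> carrier A" for a
    using M'.ract_add_left[of "\<zero>\<^bsub>M'\<^esub>" "\<zero>\<^bsub>M'\<^esub>" a, symmetric] that M'.ract_closed[of "\<zero>\<^bsub>M'\<^esub>" a]
    by simp
  then have z: "rlinear A M M' (\<lambda>x. \<zero>\<^bsub>M'\<^esub>)" by (intro rlinearI) simp_all
  have "tensor_map A M N M' N' (\<lambda>x. \<zero>\<^bsub>M'\<^esub>) g t = tensor_map A M N M' N' (\<lambda>x. \<zero>\<^bsub>M'\<^esub> \<oplus>\<^bsub>M'\<^esub> \<zero>\<^bsub>M'\<^esub>) g t"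
    by simp
  also have "\<dots> = tensor_map A M N M' N' (\<lambda>x. \<zero>\<^bsub>M'\<^esub>) g t
      \<otimes>\<^bsub>tensor_group A M' N'\<^esub> tensor_map A M N M' N' (\<lambda>x. \<zero>\<^bsub>M'\<^esub>) g t"
    by (rule tensor_map_add_left) (use assms z in auto)
  finally show ?thesis
    using tensor_map_closed[OF assms(1,2) z assms(4,5)] by (metis G.l_cancel_one')
qed

text \<open>The relations and the free group read only these three fields of the first factor, so
  the tensor products are equal and not merely isomorphic. This permits truncating a record, or
  giving a submodule a new coaction, without transporting any element.\<close>

lemma tensor_cong:
  assumes "carrier M = carrier M'" "ring.add M = ring.add M'" "ract M = ract M'"
  shows "tensor_group A M N = tensor_group A M' N"
    and "pure_tensor A M N = pure_tensor A M' N"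
    and "tensor_lift A M N = tensor_lift A M' N"
    and "tensor_map A M N = tensor_map A M' N"
    and "tensor_map A P Q M N = tensor_map A P Q M' N"
proof -
  have "tensor_sub A M N = tensor_sub A M' N"
    unfolding tensor_sub_def tensor_rels_def by (simp only: assms)
  then show g: "tensor_group A M N = tensor_group A M' N"
    and p: "pure_tensor A M N = pure_tensor A M' N"
    unfolding tensor_group_def pure_tensor_def[abs_def] by (simp_all only: assms)
  show l: "tensor_lift A M N = tensor_lift A M' N"
    unfolding tensor_lift_def[abs_def] g p by (simp only: assms)
  show "tensor_map A M N = tensor_map A M' N" "tensor_map A P Q M N = tensor_map A P Q M' N"
    unfolding tensor_map_def[abs_def] by (simp_all only: g p l)
qed

section \<open>Bimodules and the module structure on tensor products\<close>

locale bimod = right_module A N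
  for A :: "('a, 'ax) ring_scheme" (structure)
    and N :: "('a, 'n, 'nx) bimodule_scheme" (structure) +
  assumes lact_closed: "\<lbrakk>a \<in> carrier A; n \<in> carrier N\<rbrakk> \<Longrightarrow> a \<rhd>\<^bsub>N\<^esub> n \<in> carrier N"
    and lact_add_right: "\<lbrakk>a \<in> carrier A; m \<in> carrier N; n \<in> carrier N\<rbrakk> \<Longrightarrow>
      a \<rhd>\<^bsub>N\<^esub> (m \<oplus>\<^bsub>N\<^esub> n) = (a \<rhd>\<^bsub>N\<^esub> m) \<oplus>\<^bsub>N\<^esub> (a \<rhd>\<^bsub>N\<^esub> n)"
    and lact_ract: "\<lbrakk>a \<in> carrier A; n \<in> carrier N; b \<in> carrier A\<rbrakk> \<Longrightarrow>
      (a \<rhd>\<^bsub>N\<^esub> n) \<lhd>\<^bsub>N\<^esub> b = a \<rhd>\<^bsub>N\<^esub> (n \<lhd>\<^bsub>N\<^esub> b)"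

lemma (in alg_bimodule) bimod: "bimod A N"
  by unfold_locales (simp_all add: lact_closed lact_add_right lact_ract)

lemma bimod_right_module: "bimod A N \<Longrightarrow> right_module A N"
  by (rule bimod.axioms)

lemma tensor_factors_bimod:
  assumes "right_module A M" "bimod A N"
  shows "tensor_factors A M N"
proof -
  interpret M: right_module A M by fact
  interpret N: bimod A N by fact
  show ?thesis by unfold_locales (simp_all add: M.ract_closed N.lact_closed)
qed

lemma (in bimod) llinear_ract: "a \<in> carrier A \<Longrightarrow> llinear A N N (\<lambda>n. n \<lhd>\<^bsub>N\<^esub> a)"
  by (rule llinearI) (simp_all add: ract_closed ract_add_left lact_ract)

lemma (in bimod) rlinear_lact: "a \<in> carrier A \<Longrightarrow> rlinear A N N (\<lambda>n. a \<rhd>\<^bsub>N\<^esub> n)"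
  by (rule rlinearI) (simp_all add: lact_closed lact_add_right lact_ract)

lemma comm_group_cong:
  assumes "comm_group G" "carrier H = carrier G" "monoid.mult H = monoid.mult G"
    "monoid.one H = monoid.one G"
  shows "comm_group H"
proof -
  interpret G: comm_group G by fact
  show ?thesis
    by (rule comm_groupI) (auto simp: assms G.m_assoc intro: G.m_comm G.l_inv_ex)
qed

lemma abelian_groupI':
  assumes "comm_group G" "carrier M = carrier G" "ring.add M = monoid.mult G"
    "ring.zero M = monoid.one G"
  shows "abelian_group M"
  by (rule comm_group_abelian_groupI, rule comm_group_cong[OF assms(1)]) (simp_all add: assms)

lemma tensor_rmod_simps [simp]:
  "carrier (tensor_rmod A M N) = carrier (tensor_group A M N)"
  "ring.zero (tensor_rmod A M N) = monoid.one (tensor_group A M N)"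
  "ring.add (tensor_rmod A M N) = monoid.mult (tensor_group A M N)"
  "ract (tensor_rmod A M N) t a = tensor_map A M N M N (\<lambda>m. m) (\<lambda>n. n \<lhd>\<^bsub>N\<^esub> a) t"
  by (simp_all add: tensor_rmod_def)

lemma tensor_bimod_simps [simp]:
  "carrier (tensor_bimod A N P) = carrier (tensor_group A N P)"
  "ring.zero (tensor_bimod A N P) = monoid.one (tensor_group A N P)"
  "ring.add (tensor_bimod A N P) = monoid.mult (tensor_group A N P)"
  "lact (tensor_bimod A N P) a t = tensor_map A N P N P (\<lambda>m. a \<rhd>\<^bsub>N\<^esub> m) (\<lambda>n. n) t"
  by (simp_all add: tensor_bimod_def)

text \<open>The action of a is id \<otimes> (multiplication by a), so each module law is a property
  of \<open>tensor_map\<close>: additivity in t is its being a homomorphism, additivity in a is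
  additivity in the second map, associativity is composition, and the unit law is preservation of
  identities.\<close>

lemma right_module_tensor_rmod:
  assumes "right_module A M" "bimod A N"
  shows "right_module A (tensor_rmod A M N)"
proof -
  interpret M: right_module A M by fact
  interpret N: bimod A N by fact
  note F = tensor_factors_bimod[OF assms]
  interpret T: tensor_factors A M N by fact
  interpret ab: abelian_group "tensor_rmod A M N"
    by (rule abelian_groupI'[OF T.comm_group_tensor]) simp_all
  note [simp] = tensor_map_closed[OF F F] hom_mult[OF tensor_map_hom(1)[OF F F]] N.llinear_ract
  show ?thesis
  proof (unfold_locales, goal_cases)
    case (1 t a)
    then show ?case by simp
  next
    case (2 s t a)
    then show ?case by simp
  next
    case (3 t a b)
    have e: "tensor_map A M N M N (\<lambda>m. m) (\<lambda>n. n \<lhd>\<^bsub>N\<^esub> (a \<oplus>\<^bsub>A\<^esub> b)) t =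
      tensor_map A M N M N (\<lambda>m. m) (\<lambda>n. n \<lhd>\<^bsub>N\<^esub> a \<oplus>\<^bsub>N\<^esub> n \<lhd>\<^bsub>N\<^esub> b) t"
      using 3 by (intro fun_cong[OF tensor_map_cong]) (simp_all add: N.ract_add_right)
    have "llinear A N N (\<lambda>n. n \<lhd>\<^bsub>N\<^esub> a \<oplus>\<^bsub>N\<^esub> n \<lhd>\<^bsub>N\<^esub> b)"
      using N.llinear_ract[of "a \<oplus>\<^bsub>A\<^esub> b"] 3
      by (auto simp: N.ract_add_right[symmetric] N.lact_closed llinear_def hom_def)
    then show ?case
      using 3 e by (simp add: tensor_map_add_right[OF F F])
  next
    case (4 t a b)
    have "tensor_map A M N M N (\<lambda>m. m) (\<lambda>n. n \<lhd>\<^bsub>N\<^esub> (a \<otimes>\<^bsub>A\<^esub> b)) t =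
      tensor_map A M N M N (\<lambda>m. m) (\<lambda>n. n \<lhd>\<^bsub>N\<^esub> a \<lhd>\<^bsub>N\<^esub> b) t"
      using 4 by (intro fun_cong[OF tensor_map_cong]) (simp_all add: N.ract_assoc)
    with 4 show ?case by (simp add: tensor_map_comp[OF F F F])
  next
    case (5 t)
    have "tensor_map A M N M N (\<lambda>m. m) (\<lambda>n. n \<lhd>\<^bsub>N\<^esub> \<one>\<^bsub>A\<^esub>) t = tensor_map A M N M N (\<lambda>m. m) (\<lambda>n. n) t"
      using 5 by (intro fun_cong[OF tensor_map_cong]) (simp_all add: N.ract_one)
    with 5 show ?case by (simp add: tensor_map_id[OF F])
  qed
qed

text \<open>As the right factor of a further tensor product, N \<otimes> P has to supply only an
  abelian group closed under the left action, since that is what \<open>tensor_factors\<close> asks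
  for.\<close>

lemma tensor_factors_tensor_bimod:
  assumes "right_module A M" "bimod A N" "bimod A P"
  shows "tensor_factors A M (tensor_bimod A N P)"
proof -
  interpret M: right_module A M by fact
  interpret N: bimod A N by fact
  note F = tensor_factors_bimod[OF bimod_right_module[OF assms(2)] assms(3)]
  interpret T: tensor_factors A N P by fact
  interpret ab: abelian_group "tensor_bimod A N P"
    by (rule abelian_groupI'[OF T.comm_group_tensor]) simp_all
  show ?thesis
    by unfold_locales (simp_all add: M.ract_closed tensor_map_closed[OF F F] N.rlinear_lact)
qed

lemma rlinear_tensor_map:
  assumes "right_module A M" "right_module A M'" "bimod A N" "rlinear A M M' f"
  shows "rlinear A (tensor_rmod A M N) (tensor_rmod A M' N) (tensor_map A M N M' N f (\<lambda>x. x))"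
proof -
  interpret N: bimod A N by fact
  note F = tensor_factors_bimod[OF assms(1,3)] tensor_factors_bimod[OF assms(2,3)]
  show ?thesis
    by (rule rlinearI) (simp_all add: tensor_map_closed[OF F] hom_mult[OF tensor_map_hom(1)[OF F]]
        tensor_map_comp[OF F(1,1,2)] tensor_map_comp[OF F(1,2,2)] N.llinear_ract assms)
qed

subsection \<open>Associativity\<close>

locale tensor_triple = M: right_module A M + N: bimod A N + P: bimod A P
  for A :: "('a, 'ax) ring_scheme"
    and M :: "('a, 'm, 'mx) rmodule_scheme"
    and N :: "('a, 'n, 'nx) bimodule_scheme"
    and P :: "('a, 'p, 'px) bimodule_scheme"
begin

abbreviation "left_triple \<equiv> tensor_group A (tensor_rmod A M N) P"
abbreviation "right_triple \<equiv> tensor_group A M (tensor_bimod A N P)"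

sublocale MN: tensor_factors A M N
  by (rule tensor_factors_bimod) unfold_locales

sublocale NP: tensor_factors A N P
  by (rule tensor_factors_bimod) unfold_locales

sublocale L: tensor_factors A "tensor_rmod A M N" P
  by (rule tensor_factors_bimod, rule right_module_tensor_rmod) unfold_locales

sublocale R: tensor_factors A M "tensor_bimod A N P"
  by (rule tensor_factors_tensor_bimod) unfold_locales

text \<open>Two rounds of testing on pure tensors: for fixed p the map x \<mapsto> x \<otimes> p is
  a homomorphism on M \<otimes> N, so x may be taken pure as well.\<close>

lemma left_triple_hom_eqI:
  assumes "h \<in> hom left_triple G" "h' \<in> hom left_triple G" "group G"
    and "\<And>m n p. \<lbrakk>m \<in> carrier M; n \<in> carrier N; p \<in> carrier P\<rbrakk> \<Longrightarrow>
      h (pure_tensor A (tensor_rmod A M N) P (pure_tensor A M N m n) p) =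
      h' (pure_tensor A (tensor_rmod A M N) P (pure_tensor A M N m n) p)"
    and "t \<in> carrier left_triple"
  shows "h t = h' t"
proof (rule L.tensor_hom_eqI[OF assms(1-3) _ assms(5)])
  fix x p assume x: "x \<in> carrier (tensor_rmod A M N)" and p: "p \<in> carrier P"
  have e: "(\<lambda>x. pure_tensor A (tensor_rmod A M N) P x p) \<in> hom (tensor_group A M N) left_triple"
    using p L.pure_tensor_add_left by (auto simp: hom_def)
  show "h (pure_tensor A (tensor_rmod A M N) P x p) = h' (pure_tensor A (tensor_rmod A M N) P x p)"
    by (rule MN.tensor_hom_eqI[OF hom_comp[OF e assms(1)] hom_comp[OF e assms(2)] assms(3)])
      (use assms(4) p x in auto)
qed

lemma right_triple_hom_eqI:
  assumes "h \<in> hom right_triple G" "h' \<in> hom right_triple G" "group G"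
    and "\<And>m n p. \<lbrakk>m \<in> carrier M; n \<in> carrier N; p \<in> carrier P\<rbrakk> \<Longrightarrow>
      h (pure_tensor A M (tensor_bimod A N P) m (pure_tensor A N P n p)) =
      h' (pure_tensor A M (tensor_bimod A N P) m (pure_tensor A N P n p))"
    and "t \<in> carrier right_triple"
  shows "h t = h' t"
proof (rule R.tensor_hom_eqI[OF assms(1-3) _ assms(5)])
  fix m x assume x: "x \<in> carrier (tensor_bimod A N P)" and m: "m \<in> carrier M"
  have e: "(\<lambda>x. pure_tensor A M (tensor_bimod A N P) m x) \<in> hom (tensor_group A N P) right_triple"
    using m R.pure_tensor_add_right by (auto simp: hom_def)
  show "h (pure_tensor A M (tensor_bimod A N P) m x) = h' (pure_tensor A M (tensor_bimod A N P) m x)"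
    by (rule NP.tensor_hom_eqI[OF hom_comp[OF e assms(1)] hom_comp[OF e assms(2)] assms(3)])
      (use assms(4) m x in auto)
qed

text \<open>This is the inner lift in \<open>tensor_assoc\<close>. Fixing p lets a map on a triple
  product arise from the universal property of tensor products of two factors, applied
  twice.\<close>

abbreviation "assoc_inner p \<equiv> tensor_lift A M N right_triple
  (\<lambda>m n. pure_tensor A M (tensor_bimod A N P) m (pure_tensor A N P n p))"

lemma pure_lact:
  "\<lbrakk>a \<in> carrier A; n \<in> carrier N; p \<in> carrier P\<rbrakk> \<Longrightarrow>
    a \<rhd>\<^bsub>tensor_bimod A N P\<^esub> pure_tensor A N P n p = pure_tensor A N P (a \<rhd>\<^bsub>N\<^esub> n) p"
  by (simp add: tensor_map_pure[OF NP.tensor_factors_axioms NP.tensor_factors_axioms] N.rlinear_lact)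

lemma pure_ract:
  "\<lbrakk>a \<in> carrier A; m \<in> carrier M; n \<in> carrier N\<rbrakk> \<Longrightarrow>
    pure_tensor A M N m n \<lhd>\<^bsub>tensor_rmod A M N\<^esub> a = pure_tensor A M N m (n \<lhd>\<^bsub>N\<^esub> a)"
  by (simp add: tensor_map_pure[OF MN.tensor_factors_axioms MN.tensor_factors_axioms] N.llinear_ract)

lemma assoc_inner:
  assumes "p \<in> carrier P"
  shows "assoc_inner p \<in> hom (tensor_group A M N) right_triple"
    and "\<lbrakk>m \<in> carrier M; n \<in> carrier N\<rbrakk> \<Longrightarrow> assoc_inner p (pure_tensor A M N m n) =
      pure_tensor A M (tensor_bimod A N P) m (pure_tensor A N P n p)"
proof -
  have "balanced A M N right_triple
      (\<lambda>m n. pure_tensor A M (tensor_bimod A N P) m (pure_tensor A N P n p))"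
  proof (rule balancedI)
    fix m n n' assume "m \<in> carrier M" "n \<in> carrier N" "n' \<in> carrier N"
    then show "pure_tensor A M (tensor_bimod A N P) m (pure_tensor A N P (n \<oplus>\<^bsub>N\<^esub> n') p) =
      pure_tensor A M (tensor_bimod A N P) m (pure_tensor A N P n p) \<otimes>\<^bsub>right_triple\<^esub>
      pure_tensor A M (tensor_bimod A N P) m (pure_tensor A N P n' p)"
      using assms R.pure_tensor_add_right[of m "pure_tensor A N P n p" "pure_tensor A N P n' p"]
      by (simp add: NP.pure_tensor_add_left)
  next
    fix m a n assume "m \<in> carrier M" "a \<in> carrier A" "n \<in> carrier N"
    then show "pure_tensor A M (tensor_bimod A N P) (m \<lhd>\<^bsub>M\<^esub> a) (pure_tensor A N P n p) =
      pure_tensor A M (tensor_bimod A N P) m (pure_tensor A N P (a \<rhd>\<^bsub>N\<^esub> n) p)"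
      using assms R.pure_tensor_ract[of m a "pure_tensor A N P n p"] pure_lact[of a n p]
      by simp
  qed (use assms in \<open>simp_all add: R.pure_tensor_add_left\<close>)
  from MN.tensor_lift[OF R.comm_group_tensor this]
  show "assoc_inner p \<in> hom (tensor_group A M N) right_triple"
    "\<lbrakk>m \<in> carrier M; n \<in> carrier N\<rbrakk> \<Longrightarrow> assoc_inner p (pure_tensor A M N m n) =
      pure_tensor A M (tensor_bimod A N P) m (pure_tensor A N P n p)"
    by auto
qed

text \<open>Additivity in the argument from M \<otimes> N is built into
  \<open>assoc_inner p\<close>. Additivity in p and the balancing law are equalities between
  homomorphisms of that argument, so it may be taken to be a pure tensor.\<close>

lemma tensor_assoc_hom: "tensor_assoc A M N P \<in> hom left_triple right_triple"
  and tensor_assoc_pure: "\<lbrakk>m \<in> carrier M; n \<in> carrier N; p \<in> carrier P\<rbrakk> \<Longrightarrow>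
    tensor_assoc A M N P (pure_tensor A (tensor_rmod A M N) P (pure_tensor A M N m n) p) =
    pure_tensor A M (tensor_bimod A N P) m (pure_tensor A N P n p)"
proof -
  have "balanced A (tensor_rmod A M N) P right_triple (\<lambda>t p. assoc_inner p t)"
  proof (rule balancedI)
    fix x p assume "x \<in> carrier (tensor_rmod A M N)" "p \<in> carrier P"
    then show "assoc_inner p x \<in> carrier right_triple"
      using assoc_inner(1)[of p] by (auto simp: hom_def)
  next
    fix x y p assume "x \<in> carrier (tensor_rmod A M N)" "y \<in> carrier (tensor_rmod A M N)" "p \<in> carrier P"
    then show "assoc_inner p (x \<oplus>\<^bsub>tensor_rmod A M N\<^esub> y) =
        assoc_inner p x \<otimes>\<^bsub>right_triple\<^esub> assoc_inner p y"
      using hom_mult[OF assoc_inner(1)[of p]] by simp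
  next
    fix x p q assume x: "x \<in> carrier (tensor_rmod A M N)" and pq: "p \<in> carrier P" "q \<in> carrier P"
    show "assoc_inner (p \<oplus>\<^bsub>P\<^esub> q) x = assoc_inner p x \<otimes>\<^bsub>right_triple\<^esub> assoc_inner q x"
    proof (rule MN.tensor_hom_eqI[OF assoc_inner(1) hom_mult_fun[OF assoc_inner(1) assoc_inner(1)]])
      fix m n assume mn: "m \<in> carrier M" "n \<in> carrier N"
      then show "assoc_inner (p \<oplus>\<^bsub>P\<^esub> q) (pure_tensor A M N m n) = assoc_inner p (pure_tensor A M N m n)
          \<otimes>\<^bsub>right_triple\<^esub> assoc_inner q (pure_tensor A M N m n)"
        using pq R.pure_tensor_add_right[of m "pure_tensor A N P n p" "pure_tensor A N P n q"]
        by (simp add: assoc_inner(2) NP.pure_tensor_add_right)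
    qed (use x pq R.comm_group_tensor R.group_tensor in auto)
  next
    fix x a p assume x: "x \<in> carrier (tensor_rmod A M N)" and p: "a \<in> carrier A" "p \<in> carrier P"
    have r: "(\<lambda>x. x \<lhd>\<^bsub>tensor_rmod A M N\<^esub> a) \<in> hom (tensor_group A M N) (tensor_group A M N)"
      using p by (simp add: tensor_map_hom[OF MN.tensor_factors_axioms MN.tensor_factors_axioms] N.llinear_ract)
    show "assoc_inner p (x \<lhd>\<^bsub>tensor_rmod A M N\<^esub> a) = assoc_inner (a \<rhd>\<^bsub>P\<^esub> p) x"
    proof (rule MN.tensor_hom_eqI[OF hom_comp[OF r assoc_inner(1)] assoc_inner(1)])
      fix m n assume mn: "m \<in> carrier M" "n \<in> carrier N"
      show "assoc_inner p (pure_tensor A M N m n \<lhd>\<^bsub>tensor_rmod A M N\<^esub> a) =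
          assoc_inner (a \<rhd>\<^bsub>P\<^esub> p) (pure_tensor A M N m n)"
        unfolding pure_ract[OF p(1) mn]
        using mn p by (simp add: assoc_inner(2) N.ract_closed P.lact_closed NP.pure_tensor_ract)
    qed (use x p P.lact_closed R.group_tensor in auto)
  qed
  note l = L.tensor_lift[OF R.comm_group_tensor this, folded tensor_assoc_def]
  from l show "tensor_assoc A M N P \<in> hom left_triple right_triple" by blast
  show "tensor_assoc A M N P (pure_tensor A (tensor_rmod A M N) P (pure_tensor A M N m n) p) =
      pure_tensor A M (tensor_bimod A N P) m (pure_tensor A N P n p)"
    if "m \<in> carrier M" "n \<in> carrier N" "p \<in> carrier P"
    using l that assoc_inner(2) by simp
qed

text \<open>Mirror image of \<open>assoc_inner\<close>, with m fixed: n \<otimes> p goes to (m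
  \<otimes> n) \<otimes> p. The inverse of the associativity map is assembled from these because
  injectivity known for the left bracketing has to be moved to the right one.\<close>

definition assoc_inv_inner where
  "assoc_inv_inner m = tensor_lift A N P left_triple
    (\<lambda>n p. pure_tensor A (tensor_rmod A M N) P (pure_tensor A M N m n) p)"

definition assoc_inv where
  "assoc_inv = tensor_lift A M (tensor_bimod A N P) left_triple assoc_inv_inner"

lemma assoc_inv_inner:
  assumes "m \<in> carrier M"
  shows "assoc_inv_inner m \<in> hom (tensor_group A N P) left_triple"
    and "\<lbrakk>n \<in> carrier N; p \<in> carrier P\<rbrakk> \<Longrightarrow> assoc_inv_inner m (pure_tensor A N P n p) =
      pure_tensor A (tensor_rmod A M N) P (pure_tensor A M N m n) p"
proof -
  have "balanced A N P left_triple
      (\<lambda>n p. pure_tensor A (tensor_rmod A M N) P (pure_tensor A M N m n) p)"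
  proof (rule balancedI)
    fix n n' p assume "n \<in> carrier N" "n' \<in> carrier N" "p \<in> carrier P"
    then show "pure_tensor A (tensor_rmod A M N) P (pure_tensor A M N m (n \<oplus>\<^bsub>N\<^esub> n')) p =
      pure_tensor A (tensor_rmod A M N) P (pure_tensor A M N m n) p \<otimes>\<^bsub>left_triple\<^esub>
      pure_tensor A (tensor_rmod A M N) P (pure_tensor A M N m n') p"
      using assms L.pure_tensor_add_left[of "pure_tensor A M N m n" "pure_tensor A M N m n'" p]
      by (simp add: MN.pure_tensor_add_right)
  next
    fix n a p assume "n \<in> carrier N" "a \<in> carrier A" "p \<in> carrier P"
    then show "pure_tensor A (tensor_rmod A M N) P (pure_tensor A M N m (n \<lhd>\<^bsub>N\<^esub> a)) p =
      pure_tensor A (tensor_rmod A M N) P (pure_tensor A M N m n) (a \<rhd>\<^bsub>P\<^esub> p)"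
      using assms L.pure_tensor_ract[of "pure_tensor A M N m n" a p] pure_ract[of a m n] by simp
  qed (use assms in \<open>simp_all add: L.pure_tensor_add_right\<close>)
  note l = NP.tensor_lift[OF L.comm_group_tensor this, folded assoc_inv_inner_def]
  then show "assoc_inv_inner m \<in> hom (tensor_group A N P) left_triple"
    "\<lbrakk>n \<in> carrier N; p \<in> carrier P\<rbrakk> \<Longrightarrow> assoc_inv_inner m (pure_tensor A N P n p) =
      pure_tensor A (tensor_rmod A M N) P (pure_tensor A M N m n) p"
    by auto
qed

lemma assoc_inv_hom: "assoc_inv \<in> hom right_triple left_triple"
  and assoc_inv_pure: "\<lbrakk>m \<in> carrier M; n \<in> carrier N; p \<in> carrier P\<rbrakk> \<Longrightarrow>
    assoc_inv (pure_tensor A M (tensor_bimod A N P) m (pure_tensor A N P n p)) =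
    pure_tensor A (tensor_rmod A M N) P (pure_tensor A M N m n) p"
proof -
  have "balanced A M (tensor_bimod A N P) left_triple assoc_inv_inner"
  proof (rule balancedI)
    fix m x assume "x \<in> carrier (tensor_bimod A N P)" "m \<in> carrier M"
    then show "assoc_inv_inner m x \<in> carrier left_triple"
      using assoc_inv_inner(1)[of m] by (auto simp: hom_def)
  next
    fix m x y assume "x \<in> carrier (tensor_bimod A N P)" "y \<in> carrier (tensor_bimod A N P)" "m \<in> carrier M"
    then show "assoc_inv_inner m (x \<oplus>\<^bsub>tensor_bimod A N P\<^esub> y) =
        assoc_inv_inner m x \<otimes>\<^bsub>left_triple\<^esub> assoc_inv_inner m y"
      using hom_mult[OF assoc_inv_inner(1)[of m]] by simp
  next
    fix m m' x assume x: "x \<in> carrier (tensor_bimod A N P)" and m: "m \<in> carrier M" "m' \<in> carrier M"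
    show "assoc_inv_inner (m \<oplus>\<^bsub>M\<^esub> m') x = assoc_inv_inner m x \<otimes>\<^bsub>left_triple\<^esub> assoc_inv_inner m' x"
    proof (rule NP.tensor_hom_eqI[OF assoc_inv_inner(1)
          hom_mult_fun[OF assoc_inv_inner(1) assoc_inv_inner(1)]])
      fix n p assume mn: "n \<in> carrier N" "p \<in> carrier P"
      then show "assoc_inv_inner (m \<oplus>\<^bsub>M\<^esub> m') (pure_tensor A N P n p) =
          assoc_inv_inner m (pure_tensor A N P n p)
          \<otimes>\<^bsub>left_triple\<^esub> assoc_inv_inner m' (pure_tensor A N P n p)"
        using m L.pure_tensor_add_left[of "pure_tensor A M N m n" "pure_tensor A M N m' n" p]
        by (simp add: assoc_inv_inner(2) MN.pure_tensor_add_left)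
    qed (use x m L.comm_group_tensor L.group_tensor in auto)
  next
    fix m a x assume x: "x \<in> carrier (tensor_bimod A N P)" and m: "m \<in> carrier M" "a \<in> carrier A"
    have r: "(\<lambda>x. a \<rhd>\<^bsub>tensor_bimod A N P\<^esub> x) \<in> hom (tensor_group A N P) (tensor_group A N P)"
      using m by (simp add: tensor_map_hom[OF NP.tensor_factors_axioms NP.tensor_factors_axioms] N.rlinear_lact)
    show "assoc_inv_inner (m \<lhd>\<^bsub>M\<^esub> a) x = assoc_inv_inner m (a \<rhd>\<^bsub>tensor_bimod A N P\<^esub> x)"
    proof (rule NP.tensor_hom_eqI[OF assoc_inv_inner(1) hom_comp[OF r assoc_inv_inner(1)]])
      fix n p assume np: "n \<in> carrier N" "p \<in> carrier P"
      show "assoc_inv_inner (m \<lhd>\<^bsub>M\<^esub> a) (pure_tensor A N P n p) =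
          assoc_inv_inner m (a \<rhd>\<^bsub>tensor_bimod A N P\<^esub> pure_tensor A N P n p)"
        unfolding pure_lact[OF m(2) np]
        using np m by (simp add: assoc_inv_inner(2) M.ract_closed N.lact_closed MN.pure_tensor_ract)
    qed (use x m M.ract_closed L.group_tensor in auto)
  qed
  note l = R.tensor_lift[OF L.comm_group_tensor this, folded assoc_inv_def]
  from l show "assoc_inv \<in> hom right_triple left_triple" by blast
  show "assoc_inv (pure_tensor A M (tensor_bimod A N P) m (pure_tensor A N P n p)) =
      pure_tensor A (tensor_rmod A M N) P (pure_tensor A M N m n) p"
    if "m \<in> carrier M" "n \<in> carrier N" "p \<in> carrier P"
    using l that assoc_inv_inner(2) by simp
qed

text \<open>This composite is the one that recovers an element from its rebracketing; in particular
  an element with trivial rebracketing is trivial.\<close>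

lemma tensor_assoc_assoc_inv:
  assumes "t \<in> carrier right_triple"
  shows "tensor_assoc A M N P (assoc_inv t) = t"
proof (rule right_triple_hom_eqI[OF hom_comp[OF assoc_inv_hom tensor_assoc_hom] _ _ _ assms])
  show "(\<lambda>t. t) \<in> hom right_triple right_triple" by (auto simp: hom_def)
qed (simp_all add: R.group_tensor assoc_inv_pure tensor_assoc_pure)

end

text \<open>Each pair of composites agrees on triple pure tensors. The first square carries
  coassociativity between a submodule and M, the second carries injectivity from the left bracketing
  to the right one.\<close>

lemma
  assumes "right_module A M" "right_module A M'" "bimod A N" "bimod A P" "rlinear A M M' f"
  shows tensor_assoc_natural: "t \<in> carrier (tensor_group A (tensor_rmod A M N) P) \<Longrightarrow>
      tensor_assoc A M' N P (tensor_map A (tensor_rmod A M N) P (tensor_rmod A M' N) P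
        (tensor_map A M N M' N f (\<lambda>n. n)) (\<lambda>p. p) t) =
      tensor_map A M (tensor_bimod A N P) M' (tensor_bimod A N P) f (\<lambda>x. x) (tensor_assoc A M N P t)"
    and assoc_inv_natural: "s \<in> carrier (tensor_group A M (tensor_bimod A N P)) \<Longrightarrow>
      tensor_triple.assoc_inv A M' N P
        (tensor_map A M (tensor_bimod A N P) M' (tensor_bimod A N P) f (\<lambda>x. x) s) =
      tensor_map A (tensor_rmod A M N) P (tensor_rmod A M' N) P
        (tensor_map A M N M' N f (\<lambda>n. n)) (\<lambda>p. p) (tensor_triple.assoc_inv A M N P s)"
proof -
  interpret T: tensor_triple A M N P using assms by (intro tensor_triple.intro)
  interpret T': tensor_triple A M' N P using assms by (intro tensor_triple.intro)
  note LL = T.L.tensor_factors_axioms T'.L.tensor_factors_axioms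
    and RR = T.R.tensor_factors_axioms T'.R.tensor_factors_axioms
    and MM = T.MN.tensor_factors_axioms T'.MN.tensor_factors_axioms
  note r = rlinear_tensor_map[OF assms(1-3,5)]
  note [simp] = rlinearD(1)[OF assms(5)]
  show "tensor_assoc A M' N P (tensor_map A (tensor_rmod A M N) P (tensor_rmod A M' N) P
        (tensor_map A M N M' N f (\<lambda>n. n)) (\<lambda>p. p) t) =
      tensor_map A M (tensor_bimod A N P) M' (tensor_bimod A N P) f (\<lambda>x. x) (tensor_assoc A M N P t)"
    if "t \<in> carrier (tensor_group A (tensor_rmod A M N) P)"
    by (rule T.left_triple_hom_eqI[OF hom_comp[OF tensor_map_hom(1)[OF LL r] T'.tensor_assoc_hom]
          hom_comp[OF T.tensor_assoc_hom tensor_map_hom(1)[OF RR assms(5)]] T'.R.group_tensor _ that])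
      (simp_all add: tensor_map_pure[OF LL r] tensor_map_pure[OF RR assms(5)]
        tensor_map_pure[OF MM assms(5)] T.tensor_assoc_pure T'.tensor_assoc_pure)
  show "tensor_triple.assoc_inv A M' N P
        (tensor_map A M (tensor_bimod A N P) M' (tensor_bimod A N P) f (\<lambda>x. x) s) =
      tensor_map A (tensor_rmod A M N) P (tensor_rmod A M' N) P
        (tensor_map A M N M' N f (\<lambda>n. n)) (\<lambda>p. p) (tensor_triple.assoc_inv A M N P s)"
    if "s \<in> carrier (tensor_group A M (tensor_bimod A N P))"
    by (rule T.right_triple_hom_eqI[OF hom_comp[OF tensor_map_hom(1)[OF RR assms(5)] T'.assoc_inv_hom]
          hom_comp[OF T.assoc_inv_hom tensor_map_hom(1)[OF LL r]] T'.L.group_tensor _ that])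
      (simp_all add: tensor_map_pure[OF LL r] tensor_map_pure[OF RR assms(5)]
        tensor_map_pure[OF MM assms(5)] T.assoc_inv_pure T'.assoc_inv_pure)
qed

section \<open>Flatness and submodules\<close>

lemma right_module_cong:
  assumes "right_module A M" "carrier M' = carrier M" "ring.add M' = ring.add M"
    "ring.zero M' = ring.zero M" "ract M' = ract M"
  shows "right_module A M'"
proof -
  interpret M: right_module A M by fact
  interpret abelian_group M'
    by (rule abelian_groupI'[OF M.M.a_comm_group]) (simp_all add: assms)
  show ?thesis
    by unfold_locales
      (simp_all add: assms M.ract_closed M.ract_add_left M.ract_add_right M.ract_assoc M.ract_one)
qed

lemma rmodule_truncate_simps:
  "carrier (rmodule.truncate M) = carrier M" "ring.add (rmodule.truncate M) = ring.add M"
  "ring.zero (rmodule.truncate M) = ring.zero M" "ract (rmodule.truncate M) = ract M"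
  by (simp_all add: rmodule.truncate_def)

text \<open>\<open>flat_left\<close> tests plain \<open>rmodule\<close> records, while comodules and
  their restrictions carry further fields. Truncation removes these and by
  \<open>tensor_cong\<close> leaves the tensor products unchanged.\<close>

lemma flat_left_inj:
  fixes X :: "('a, 'u, 'x) rmodule_scheme" and Y :: "('a, 'u, 'y) rmodule_scheme"
  assumes "flat_left TYPE('u) A N" "right_module A X" "right_module A Y" "rlinear A X Y f"
    "inj_on f (carrier X)"
  shows "inj_on (tensor_map A X N Y N f (\<lambda>n. n)) (carrier (tensor_group A X N))"
proof -
  let ?X = "rmodule.truncate X" and ?Y = "rmodule.truncate Y"
  note s = rmodule_truncate_simps[of X] rmodule_truncate_simps[of Y]
  have "right_module A ?X" "right_module A ?Y"
    by (rule right_module_cong[OF assms(2)], (rule s)+)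
      (rule right_module_cong[OF assms(3)], (rule s)+)
  moreover have "rlinear A ?X ?Y f"
    using assms(4) by (simp add: rlinear_def hom_def s)
  ultimately have "inj_on (tensor_map A ?X N ?Y N f (\<lambda>n. n)) (carrier (tensor_group A ?X N))"
    using assms(1,5) unfolding flat_left_def by (simp add: s)
  then show ?thesis
    unfolding tensor_cong[where N = N, OF s(1,2,4)] tensor_cong(5)[where N = N, OF s(5,6,8)] .
qed

section \<open>Submodules, and exactness of the tensor product at a kernel\<close>

definition submod ::
  "('a, 'ax) ring_scheme \<Rightarrow> ('a, 'm, 'mx) rmodule_scheme \<Rightarrow> 'm set \<Rightarrow> bool" where
  "submod A M K \<longleftrightarrow> subgroup K (add_monoid M) \<and>
     (\<forall>k\<in>K. \<forall>a\<in>carrier A. k \<lhd>\<^bsub>M\<^esub> a \<in> K)"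

context right_module
begin

lemma submod_subset: "submod A M K \<Longrightarrow> K \<subseteq> carrier M"
  unfolding submod_def by (metis partial_object.select_convs(1) subgroup.subset)

lemma submod_zero: "submod A M K \<Longrightarrow> \<zero>\<^bsub>M\<^esub> \<in> K"
  using subgroup.one_closed[of K "add_monoid M"] by (simp add: submod_def)

lemma submod_add: "\<lbrakk>submod A M K; x \<in> K; y \<in> K\<rbrakk> \<Longrightarrow> x \<oplus>\<^bsub>M\<^esub> y \<in> K"
  using subgroup.m_closed[of K "add_monoid M"] by (simp add: submod_def)

lemma submod_minus: "\<lbrakk>submod A M K; x \<in> K\<rbrakk> \<Longrightarrow> \<ominus>\<^bsub>M\<^esub> x \<in> K"
  using subgroup.m_inv_closed[of K "add_monoid M"] by (simp add: submod_def a_inv_def)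

lemma submod_ract: "\<lbrakk>submod A M K; x \<in> K; a \<in> carrier A\<rbrakk> \<Longrightarrow> x \<lhd>\<^bsub>M\<^esub> a \<in> K"
  by (simp add: submod_def)

lemma submodI:
  assumes "K \<subseteq> carrier M" "\<zero>\<^bsub>M\<^esub> \<in> K" "\<And>x y. \<lbrakk>x \<in> K; y \<in> K\<rbrakk> \<Longrightarrow> x \<oplus>\<^bsub>M\<^esub> y \<in> K"
    "\<And>x. x \<in> K \<Longrightarrow> \<ominus>\<^bsub>M\<^esub> x \<in> K" "\<And>x a. \<lbrakk>x \<in> K; a \<in> carrier A\<rbrakk> \<Longrightarrow> x \<lhd>\<^bsub>M\<^esub> a \<in> K"
  shows "submod A M K"
  unfolding submod_def using assms
  by (auto intro!: subgroup.intro simp: a_inv_def)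

lemma zero_ract: "a \<in> carrier A \<Longrightarrow> \<zero>\<^bsub>M\<^esub> \<lhd>\<^bsub>M\<^esub> a = \<zero>\<^bsub>M\<^esub>"
  using ract_add_left[of "\<zero>\<^bsub>M\<^esub>" "\<zero>\<^bsub>M\<^esub>" a, symmetric] ract_closed[of "\<zero>\<^bsub>M\<^esub>" a] by simp

lemma minus_ract: "\<lbrakk>x \<in> carrier M; a \<in> carrier A\<rbrakk> \<Longrightarrow> (\<ominus>\<^bsub>M\<^esub> x) \<lhd>\<^bsub>M\<^esub> a = \<ominus>\<^bsub>M\<^esub> (x \<lhd>\<^bsub>M\<^esub> a)"
  by (rule M.minus_equality[symmetric])
    (simp_all add: ract_add_left[symmetric] zero_ract ract_closed M.l_neg)

lemma submod_carrier: "submod A M (carrier M)"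
  by (rule submodI) (simp_all add: ract_closed)

lemma right_module_submod:
  assumes "submod A M K"
  shows "right_module A (M\<lparr>carrier := K\<rparr>)"
proof -
  note [simp] = submod_zero[OF assms] submod_add[OF assms] submod_minus[OF assms]
    submod_ract[OF assms] subsetD[OF submod_subset[OF assms]]
  interpret S: abelian_group "M\<lparr>carrier := K\<rparr>"
  proof (rule abelian_groupI)
    fix x assume "x \<in> carrier (M\<lparr>carrier := K\<rparr>)"
    then show "\<exists>y\<in>carrier (M\<lparr>carrier := K\<rparr>). y \<oplus>\<^bsub>M\<lparr>carrier := K\<rparr>\<^esub> x = \<zero>\<^bsub>M\<lparr>carrier := K\<rparr>\<^esub>"
      by (intro bexI[of _ "\<ominus>\<^bsub>M\<^esub> x"]) (simp_all add: M.l_neg)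
  qed (auto simp: M.a_ac)
  show ?thesis
    by unfold_locales (simp_all add: ract_add_left ract_add_right ract_assoc ract_one)
qed

lemma rlinear_inclusion: "K \<subseteq> carrier M \<Longrightarrow> rlinear A (M\<lparr>carrier := K\<rparr>) M (\<lambda>k. k)"
  by (rule rlinearI) auto

end

text \<open>Factor f as a surjection of L onto its image I followed by the inclusion of I into M.
  Flatness removes the inclusion, so t already dies in I \<otimes> N. The rest is right exactness:
  with J the image of Ker f \<otimes> N, a map g from I \<otimes> N to (L \<otimes> N)/J is built
  whose composite with f \<otimes> N is the quotient map, and therefore t lies in J.\<close>

lemma tensor_kernel_image:
  fixes L :: "('a, 'l, 'lx) rmodule_scheme" and M :: "('a, 'm, 'mx) rmodule_scheme"
  assumes flat: "flat_left TYPE('m) A N" and N: "bimod A N"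
    and L: "right_module A L" and M: "right_module A M" and f: "rlinear A L M f"
    and t: "t \<in> carrier (tensor_group A L N)"
    and z: "tensor_map A L N M N f (\<lambda>n. n) t = \<one>\<^bsub>tensor_group A M N\<^esub>"
  shows "t \<in> tensor_map A (L\<lparr>carrier := {x \<in> carrier L. f x = \<zero>\<^bsub>M\<^esub>}\<rparr>) N L N (\<lambda>x. x) (\<lambda>n. n) `
    carrier (tensor_group A (L\<lparr>carrier := {x \<in> carrier L. f x = \<zero>\<^bsub>M\<^esub>}\<rparr>) N)"
proof -
  interpret L: right_module A L by fact
  interpret M: right_module A M by fact
  interpret N: bimod A N by fact
  note [simp] = rlinearD[OF f] rlinear_zero_minus[OF f L.M.abelian_group_axioms M.M.abelian_group_axioms]
  let ?k = "{x \<in> carrier L. f x = \<zero>\<^bsub>M\<^esub>}"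
  define K where "K = L\<lparr>carrier := ?k\<rparr>"
  have sk: "submod A L ?k"
    by (rule L.submodI) (auto simp: L.ract_closed M.zero_ract)
  have K: "right_module A K" unfolding K_def by (rule L.right_module_submod[OF sk])
  have inc: "rlinear A K L (\<lambda>x. x)" unfolding K_def by (rule L.rlinear_inclusion) auto
  \<comment> \<open>The image, unlike L, has its elements in the type of M, which is the type at
    which flatness is assumed.\<close>
  define I where "I = M\<lparr>carrier := f ` carrier L\<rparr>"
  have si: "submod A M (f ` carrier L)"
  proof (rule M.submodI)
    show "\<zero>\<^bsub>M\<^esub> \<in> f ` carrier L" by (rule image_eqI[of _ _ "\<zero>\<^bsub>L\<^esub>"]) simp_all
    show "x \<oplus>\<^bsub>M\<^esub> y \<in> f ` carrier L" if "x \<in> f ` carrier L" "y \<in> f ` carrier L" for x y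
      using that by (metis (no_types, lifting) L.M.add.m_closed image_iff rlinearD(2)[OF f])
    show "\<ominus>\<^bsub>M\<^esub> x \<in> f ` carrier L" if "x \<in> f ` carrier L" for x
      using that by (metis (no_types, lifting) L.M.a_inv_closed image_iff
          rlinear_zero_minus(2)[OF f L.M.abelian_group_axioms M.M.abelian_group_axioms])
    show "x \<lhd>\<^bsub>M\<^esub> a \<in> f ` carrier L" if "x \<in> f ` carrier L" "a \<in> carrier A" for x a
      using that by (metis (no_types, lifting) L.ract_closed image_iff rlinearD(3)[OF f])
  qed auto
  have I: "right_module A I" unfolding I_def by (rule M.right_module_submod[OF si])
  have incI: "rlinear A I M (\<lambda>x. x)" unfolding I_def
    by (rule M.rlinear_inclusion[OF M.submod_subset[OF si]])
  have fI: "rlinear A L I f" unfolding I_def by (rule rlinearI) auto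
  note FL = tensor_factors_bimod[OF L N] and FK = tensor_factors_bimod[OF K N]
    and FI = tensor_factors_bimod[OF I N] and FM = tensor_factors_bimod[OF M N]
  interpret TL: tensor_factors A L N by (rule FL)
  interpret TK: tensor_factors A K N by (rule FK)
  interpret TI: tensor_factors A I N by (rule FI)
  interpret TM: tensor_factors A M N by (rule FM)
  interpret GL: comm_group "tensor_group A L N" by (rule TL.comm_group_tensor)
  have "inj_on (tensor_map A I N M N (\<lambda>x. x) (\<lambda>n. n)) (carrier (tensor_group A I N))"
    by (rule flat_left_inj[OF flat I M incI]) simp
  moreover have "tensor_map A I N M N (\<lambda>x. x) (\<lambda>n. n) (tensor_map A L N I N f (\<lambda>n. n) t) =
      \<one>\<^bsub>tensor_group A M N\<^esub>"
    using z t by (simp add: tensor_map_comp[OF FL FI FM fI _ incI])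
  ultimately have z': "tensor_map A L N I N f (\<lambda>n. n) t = \<one>\<^bsub>tensor_group A I N\<^esub>"
    using tensor_map_closed[OF FL FI fI llinear_id t]
      inj_on_hom_iff[OF tensor_map_hom(1)[OF FI FM incI llinear_id] TI.group_tensor TM.group_tensor]
    by blast
  define j where "j = tensor_map A K N L N (\<lambda>x. x) (\<lambda>n. n)"
  define J where "J = j ` carrier (tensor_group A K N)"
  have j: "j \<in> hom (tensor_group A K N) (tensor_group A L N)"
    unfolding j_def by (rule tensor_map_hom(1)[OF FK FL inc llinear_id])
  interpret j: group_hom "tensor_group A K N" "tensor_group A L N" j
    using j TK.group_tensor by (simp add: group_hom.intro group_hom_axioms.intro)
  have J: "subgroup J (tensor_group A L N)"
    unfolding J_def by (rule j.img_is_subgroup)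
  have Jpure: "pure_tensor A L N x n \<in> J" if "x \<in> ?k" "n \<in> carrier N" for x n
  proof -
    have x: "x \<in> carrier K" using that by (simp add: K_def)
    then have "j (pure_tensor A K N x n) = pure_tensor A L N x n"
      unfolding j_def by (rule tensor_map_pure[OF FK FL inc llinear_id]) fact
    then show ?thesis
      unfolding J_def using TK.pure_tensor_closed[OF x that(2)] by (metis imageI)
  qed
  define Q where "Q = tensor_group A L N Mod J"
  have nJ: "J \<lhd> tensor_group A L N" using J GL.normal_iff_subgroup by blast
  have cQ: "comm_group Q" unfolding Q_def by (rule GL.abelian_FactGroup[OF J])
  let ?q = "\<lambda>t. J #>\<^bsub>tensor_group A L N\<^esub> t"
  have q: "?q \<in> hom (tensor_group A L N) Q"
    unfolding Q_def by (rule normal.r_coset_hom_Mod[OF nJ])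
  \<comment> \<open>Preimages of the same element differ by an element of the kernel, so modulo J
    the choice of preimage is immaterial.\<close>
  have qpure: "?q (pure_tensor A L N x n) = ?q (pure_tensor A L N y n)"
    if "x \<in> carrier L" "y \<in> carrier L" "f x = f y" "n \<in> carrier N" for x y n
  proof -
    have d: "x \<ominus>\<^bsub>L\<^esub> y \<in> ?k" using that by (simp add: M.M.r_neg a_minus_def)
    have "x = (x \<ominus>\<^bsub>L\<^esub> y) \<oplus>\<^bsub>L\<^esub> y"
      using that by (simp add: a_minus_def L.M.a_assoc L.M.l_neg)
    then have "pure_tensor A L N x n =
        pure_tensor A L N (x \<ominus>\<^bsub>L\<^esub> y) n \<otimes>\<^bsub>tensor_group A L N\<^esub> pure_tensor A L N y n"
      using TL.pure_tensor_add_left[of "x \<ominus>\<^bsub>L\<^esub> y" y n] that by simp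
    then have "pure_tensor A L N x n \<in> ?q (pure_tensor A L N y n)"
      unfolding r_coset_def using Jpure[OF d that(4)] by blast
    then show ?thesis
      using GL.repr_independence[OF _ _ J] that by (metis TL.pure_tensor_closed)
  qed
  \<comment> \<open>An arbitrary section of f, in general neither additive nor linear;
    \<open>qpure\<close> makes the induced map balanced all the same.\<close>
  define s where "s = inv_into (carrier L) f"
  have s: "s y \<in> carrier L" "f (s y) = y" if "y \<in> carrier I" for y
    using that unfolding s_def I_def by (auto intro: inv_into_into f_inv_into_f)
  have b: "balanced A I N Q (\<lambda>y n. ?q (pure_tensor A L N (s y) n))"
  proof (rule balancedI)
    fix y n assume "y \<in> carrier I" "n \<in> carrier N"
    then show "?q (pure_tensor A L N (s y) n) \<in> carrier Q"
      using q s(1) by (simp add: hom_def Pi_def)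
  next
    fix y y' n assume *: "y \<in> carrier I" "y' \<in> carrier I" "n \<in> carrier N"
    then have "y \<oplus>\<^bsub>I\<^esub> y' \<in> carrier I" by simp
    then have "?q (pure_tensor A L N (s (y \<oplus>\<^bsub>I\<^esub> y')) n) = ?q (pure_tensor A L N (s y \<oplus>\<^bsub>L\<^esub> s y') n)"
      using * s by (intro qpure) (simp_all, simp add: I_def)
    also have "\<dots> = ?q (pure_tensor A L N (s y) n) \<otimes>\<^bsub>Q\<^esub> ?q (pure_tensor A L N (s y') n)"
      using * s(1) by (simp add: TL.pure_tensor_add_left hom_mult[OF q])
    finally show "?q (pure_tensor A L N (s (y \<oplus>\<^bsub>I\<^esub> y')) n) =
      ?q (pure_tensor A L N (s y) n) \<otimes>\<^bsub>Q\<^esub> ?q (pure_tensor A L N (s y') n)" .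
  next
    fix y n n' assume "y \<in> carrier I" "n \<in> carrier N" "n' \<in> carrier N"
    then show "?q (pure_tensor A L N (s y) (n \<oplus>\<^bsub>N\<^esub> n')) =
      ?q (pure_tensor A L N (s y) n) \<otimes>\<^bsub>Q\<^esub> ?q (pure_tensor A L N (s y) n')"
      using s(1) by (simp add: TL.pure_tensor_add_right hom_mult[OF q])
  next
    fix y a n assume *: "y \<in> carrier I" "a \<in> carrier A" "n \<in> carrier N"
    then have "y \<lhd>\<^bsub>I\<^esub> a \<in> carrier I" by (simp add: TI.ract_closed)
    then have "?q (pure_tensor A L N (s (y \<lhd>\<^bsub>I\<^esub> a)) n) = ?q (pure_tensor A L N (s y \<lhd>\<^bsub>L\<^esub> a) n)"
      using * s by (intro qpure) (simp_all add: L.ract_closed, simp add: I_def)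
    then show "?q (pure_tensor A L N (s (y \<lhd>\<^bsub>I\<^esub> a)) n) = ?q (pure_tensor A L N (s y) (a \<rhd>\<^bsub>N\<^esub> n))"
      using * s(1) by (simp add: TL.pure_tensor_ract)
  qed
  define g where "g = tensor_lift A I N Q (\<lambda>y n. ?q (pure_tensor A L N (s y) n))"
  have g: "g \<in> hom (tensor_group A I N) Q"
    "\<And>y n. \<lbrakk>y \<in> carrier I; n \<in> carrier N\<rbrakk> \<Longrightarrow> g (pure_tensor A I N y n) = ?q (pure_tensor A L N (s y) n)"
    using TI.tensor_lift[OF cQ b, folded g_def] by auto
  have gQ: "group Q" using cQ comm_group.axioms(2) by blast
  \<comment> \<open>The quotient map factors through f \<otimes> N: on x \<otimes> n the section
    returns some preimage of f x, which \<open>qpure\<close> identifies with x modulo J.\<close>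
  have "?q t = g (tensor_map A L N I N f (\<lambda>n. n) t)"
  proof (rule TL.tensor_hom_eqI[OF q hom_comp[OF tensor_map_hom(1)[OF FL FI fI llinear_id] g(1)] gQ _ t])
    fix x n assume *: "x \<in> carrier L" "n \<in> carrier N"
    then have "f x \<in> carrier I" by (simp add: I_def)
    then show "?q (pure_tensor A L N x n) = g (tensor_map A L N I N f (\<lambda>n. n) (pure_tensor A L N x n))"
      using * s by (simp add: tensor_map_pure[OF FL FI fI llinear_id] g(2)) (rule qpure; simp)
  qed
  also have "\<dots> = \<one>\<^bsub>Q\<^esub>"
    unfolding z' by (rule hom_one[OF g(1) TI.group_tensor gQ])
  finally have "?q t = J" by (simp add: Q_def)
  then have "t \<in> J" using GL.rcos_self[OF t J] by simp
  then show ?thesis unfolding J_def j_def K_def .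
qed

section \<open>Subcomodules over a flat coring\<close>

lemma tensor_rmod_cong:
  assumes "carrier M = carrier M'" "ring.add M = ring.add M'" "ract M = ract M'"
  shows "tensor_rmod A M N = tensor_rmod A M' N"
  unfolding tensor_rmod_def tensor_cong[OF assms] by simp

lemma tensor_assoc_cong:
  assumes "carrier M = carrier M'" "ring.add M = ring.add M'" "ract M = ract M'"
  shows "tensor_assoc A M N P = tensor_assoc A M' N P"
  unfolding tensor_assoc_def tensor_cong[OF assms] tensor_rmod_cong[OF assms] by simp

text \<open>The two instances of flatness are the types where injectivity is tested: submodules of M
  have elements in \<open>'m\<close>, while K \<otimes> C and M \<otimes> C have elements in
  \<open>('m, 'c) tens\<close>.\<close>

locale flat_comodule = C: coring R A C + M: right_comodule A C M
  for R :: "('r, 'rx) ring_scheme"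
    and A :: "('r, 'a, 'ax) module_scheme"
    and C :: "('a, 'c, 'cx) coring_scheme"
    and M :: "('a, 'm, 'c, 'mx) comodule_scheme" +
  assumes flat: "flat_left TYPE('m) A C"
    and flat_tens: "flat_left TYPE(('m, 'c) tens) A C"
begin

lemma bimod_C: "bimod A C" by (rule C.bimodule.bimod)

lemma right_module_M: "right_module A M" by unfold_locales

lemma tensor_factors_C: "right_module A X \<Longrightarrow> tensor_factors A X C"
  by (rule tensor_factors_bimod[OF _ bimod_C])

lemmas FM = tensor_factors_C[OF right_module_M]

sublocale MC: tensor_factors A M C by (rule FM)

lemma group_MC: "group (tensor_group A M C)" by (rule MC.group_tensor)

lemma coact_hom: "coact M \<in> hom (add_monoid M) (tensor_group A M C)"
  using M.coact_rlinear by (simp add: rlinear_def hom_def)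

lemma coact_closed: "m \<in> carrier M \<Longrightarrow> coact M m \<in> carrier (tensor_group A M C)"
  using coact_hom by (simp add: hom_def Pi_def)

lemma coact_zero: "coact M \<zero>\<^bsub>M\<^esub> = \<one>\<^bsub>tensor_group A M C\<^esub>"
  using hom_one[OF coact_hom M.right.M.a_group group_MC] by simp

lemma coact_minus:
  "m \<in> carrier M \<Longrightarrow> coact M (\<ominus>\<^bsub>M\<^esub> m) = inv\<^bsub>tensor_group A M C\<^esub> coact M m"
  using hom_inv[OF coact_hom M.right.M.a_group group_MC] by (simp add: a_inv_def)

lemma llinear_comult: "llinear A C (tensor_bimod A C C) (comult C)"
  using C.comult_rlinear C.comult_lact by (simp add: rlinear_def llinear_def)

text \<open>As a subset of M \<otimes> C it lets the condition on K be phrased by the coaction of M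
  alone, with no coaction on K chosen beforehand.\<close>

abbreviation sub_tensor :: "'m set \<Rightarrow> ('m, 'c) tens set" where
  "sub_tensor K \<equiv> tensor_map A (M\<lparr>carrier := K\<rparr>) C M C (\<lambda>k. k) (\<lambda>c. c) `
     carrier (tensor_group A (M\<lparr>carrier := K\<rparr>) C)"

context
  fixes K assumes K: "submod A M K"
begin

lemma right_module_K: "right_module A (M\<lparr>carrier := K\<rparr>)"
  by (rule M.right.right_module_submod[OF K])

lemma rlinear_K: "rlinear A (M\<lparr>carrier := K\<rparr>) M (\<lambda>k. k)"
  by (rule M.right.rlinear_inclusion[OF M.right.submod_subset[OF K]])

lemma inj_K: "inj_on (tensor_map A (M\<lparr>carrier := K\<rparr>) C M C (\<lambda>k. k) (\<lambda>c. c))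
    (carrier (tensor_group A (M\<lparr>carrier := K\<rparr>) C))"
  by (rule flat_left_inj[OF flat right_module_K right_module_M rlinear_K]) simp

text \<open>Flatness of \<open>C \<otimes> C\<close>, obtained from that of \<open>C\<close> by associativity.\<close>

lemma inj_K_CC:
  "inj_on (tensor_map A (M\<lparr>carrier := K\<rparr>) (tensor_bimod A C C) M (tensor_bimod A C C) (\<lambda>k. k) (\<lambda>c. c))
    (carrier (tensor_group A (M\<lparr>carrier := K\<rparr>) (tensor_bimod A C C)))"
proof -
  let ?S = "M\<lparr>carrier := K\<rparr>" and ?CC = "tensor_bimod A C C"
  let ?i = "tensor_map A ?S C M C (\<lambda>k. k) (\<lambda>c. c)"
  interpret TS: tensor_triple A ?S C C
    by (intro tensor_triple.intro right_module_K bimod_C)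
  interpret TM: tensor_triple A M C C
    by (intro tensor_triple.intro right_module_M bimod_C)
  note r = rlinear_tensor_map[OF right_module_K right_module_M bimod_C rlinear_K]
  \<comment> \<open>Flatness is used twice in a row: once in \<open>inj_K\<close>, making K
    \<otimes> C \<rightarrow> M \<otimes> C injective, and once more for this injective map.\<close>
  have ii: "inj_on (tensor_map A (tensor_rmod A ?S C) C (tensor_rmod A M C) C ?i (\<lambda>c. c))
      (carrier TS.left_triple)"
    by (rule flat_left_inj[OF flat_tens right_module_tensor_rmod right_module_tensor_rmod r])
      (simp_all add: right_module_K right_module_M bimod_C inj_K)
  note h = tensor_map_hom(1)[OF TS.R.tensor_factors_axioms TM.R.tensor_factors_axioms rlinear_K llinear_id]
    and h' = tensor_map_hom(1)[OF TS.L.tensor_factors_axioms TM.L.tensor_factors_axioms r llinear_id]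
  show ?thesis
    unfolding inj_on_hom_iff[OF h TS.R.group_tensor TM.R.group_tensor]
  proof (intro ballI impI)
    fix s assume s: "s \<in> carrier TS.right_triple"
      and z: "tensor_map A ?S ?CC M ?CC (\<lambda>k. k) (\<lambda>c. c) s = \<one>\<^bsub>TM.right_triple\<^esub>"
    have c: "TS.assoc_inv s \<in> carrier TS.left_triple"
      using TS.assoc_inv_hom s by (auto simp: hom_def)
    have "tensor_map A (tensor_rmod A ?S C) C (tensor_rmod A M C) C ?i (\<lambda>c. c) (TS.assoc_inv s) =
        TM.assoc_inv \<one>\<^bsub>TM.right_triple\<^esub>"
      using assoc_inv_natural[OF right_module_K right_module_M bimod_C bimod_C rlinear_K s] z by simp
    also have "\<dots> = \<one>\<^bsub>TM.left_triple\<^esub>"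
      by (rule hom_one[OF TM.assoc_inv_hom TM.R.group_tensor TM.L.group_tensor])
    finally have "TS.assoc_inv s = \<one>\<^bsub>TS.left_triple\<^esub>"
      using ii c unfolding inj_on_hom_iff[OF h' TS.L.group_tensor TM.L.group_tensor] by blast
    then have "s = tensor_assoc A ?S C C \<one>\<^bsub>TS.left_triple\<^esub>"
      using TS.tensor_assoc_assoc_inv[OF s] by simp
    then show "s = \<one>\<^bsub>TS.right_triple\<^esub>"
      using hom_one[OF TS.tensor_assoc_hom TS.L.group_tensor TS.R.group_tensor] by simp
  qed
qed

end

text \<open>The contraction is balanced because the counit is left linear: (x a) \<epsilon>(c) = x
  (a \<epsilon>(c)) = x \<epsilon>(a c).\<close>

lemma counit_lift:
  assumes "right_module A X"
  shows "tensor_lift A X C (add_monoid X) (\<lambda>n d. n \<lhd>\<^bsub>X\<^esub> counit C d) \<in> hom (tensor_group A X C) (add_monoid X)"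
    and "\<lbrakk>x \<in> carrier X; c \<in> carrier C\<rbrakk> \<Longrightarrow>
      tensor_lift A X C (add_monoid X) (\<lambda>n d. n \<lhd>\<^bsub>X\<^esub> counit C d) (pure_tensor A X C x c) = x \<lhd>\<^bsub>X\<^esub> counit C c"
proof -
  interpret X: right_module A X by fact
  interpret T: tensor_factors A X C by (rule tensor_factors_C[OF assms])
  have e: "counit C c \<in> carrier A" if "c \<in> carrier C" for c
    using C.counit_hom that by (auto simp: hom_def)
  have e2: "counit C (c \<oplus>\<^bsub>C\<^esub> d) = counit C c \<oplus>\<^bsub>A\<^esub> counit C d" if "c \<in> carrier C" "d \<in> carrier C" for c d
    using C.counit_hom that by (auto simp: hom_def)
  have "balanced A X C (add_monoid X) (\<lambda>n d. n \<lhd>\<^bsub>X\<^esub> counit C d)"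
    by (rule balancedI)
      (simp_all add: e e2 X.ract_closed X.ract_add_left X.ract_add_right C.counit_lact X.ract_assoc)
  from T.tensor_lift[OF X.M.a_comm_group this] show
    "tensor_lift A X C (add_monoid X) (\<lambda>n d. n \<lhd>\<^bsub>X\<^esub> counit C d) \<in> hom (tensor_group A X C) (add_monoid X)"
    "\<lbrakk>x \<in> carrier X; c \<in> carrier C\<rbrakk> \<Longrightarrow>
      tensor_lift A X C (add_monoid X) (\<lambda>n d. n \<lhd>\<^bsub>X\<^esub> counit C d) (pure_tensor A X C x c) = x \<lhd>\<^bsub>X\<^esub> counit C c"
    by auto
qed

text \<open>The coaction on K is that of M pulled back along the injective map i from K \<otimes> C
  to M \<otimes> C. Injectivity of i gives its linearity, and \<open>inj_K_CC\<close> gives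
  coassociativity, since both sides agree in M \<otimes> (C \<otimes> C). The counit law comes from
  contraction commuting with the inclusion of K.\<close>

lemma subcomoduleI:
  assumes K: "submod A M K" and im: "\<And>k. k \<in> K \<Longrightarrow> coact M k \<in> sub_tensor K"
  shows "subcomodule A C M K"
proof -
  define S where "S = M\<lparr>carrier := K\<rparr>"
  define i where "i = tensor_map A S C M C (\<lambda>k. k) (\<lambda>c. c)"
  define \<rho> where "\<rho> = (\<lambda>k. inv_into (carrier (tensor_group A S C)) i (coact M k))"
  \<comment> \<open>\<open>S'\<close> carries the new coaction and \<open>S\<close> the old one.
    Since tensor products ignore this field, the laws are computed with \<open>S\<close> and
    rewritten to \<open>S'\<close> at the end.\<close>
  define S' where "S' = M\<lparr>carrier := K, coact := \<rho>\<rparr>"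
  have eqs: "carrier S' = carrier S" "ring.add S' = ring.add S" "ract S' = ract S"
    by (simp_all add: S'_def S_def)
  have SM: "ring.add S = ring.add M" "ract S = ract M"
    by (simp_all add: S_def)
  have zS: "ring.zero S' = ring.zero S" "coact S' = \<rho>" and carrier_S: "carrier S = K"
    by (simp_all add: S'_def S_def)
  have Kc: "k \<in> carrier M" if "k \<in> K" for k using M.right.submod_subset[OF K] that by blast
  have S: "right_module A S" unfolding S_def by (rule right_module_K[OF K])
  have rS: "rlinear A S M (\<lambda>k. k)" unfolding S_def by (rule rlinear_K[OF K])
  note FS = tensor_factors_C[OF S]
  interpret S: right_module A S by (rule S)
  interpret SC: tensor_factors A S C by (rule FS)
  have inj: "inj_on i (carrier (tensor_group A S C))"
    unfolding i_def S_def by (rule inj_K[OF K])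
  have \<rho>: "\<rho> k \<in> carrier (tensor_group A S C)" "i (\<rho> k) = coact M k" if "k \<in> K" for k
    unfolding \<rho>_def
    using inv_into_into f_inv_into_f im[OF that, folded S_def, folded i_def] by metis+
  have ihom: "i \<in> hom (tensor_group A S C) (tensor_group A M C)"
    unfolding i_def by (rule tensor_map_hom(1)[OF FS FM rS llinear_id])
  have ri: "rlinear A (tensor_rmod A S C) (tensor_rmod A M C) i"
    unfolding i_def by (rule rlinear_tensor_map[OF S right_module_M bimod_C rS])
  interpret tS: right_module A "tensor_rmod A S C" by (rule right_module_tensor_rmod[OF S bimod_C])
  have rho_eq: "\<rho> k = t" if "k \<in> K" "t \<in> carrier (tensor_group A S C)" "i t = coact M k" for k t
    using \<rho>[OF that(1)] that inj by (metis inj_onD)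
  have r\<rho>: "rlinear A S (tensor_rmod A S C) \<rho>"
  proof (rule rlinearI)
    fix k assume "k \<in> carrier S"
    then show "\<rho> k \<in> carrier (tensor_rmod A S C)" using \<rho>(1) carrier_S by simp
  next
    fix k l assume "k \<in> carrier S" "l \<in> carrier S"
    then have kl: "k \<in> K" "l \<in> K" "k \<oplus>\<^bsub>S\<^esub> l \<in> K" using S.M.a_closed carrier_S by auto
    show "\<rho> (k \<oplus>\<^bsub>S\<^esub> l) = \<rho> k \<oplus>\<^bsub>tensor_rmod A S C\<^esub> \<rho> l"
    proof (rule rho_eq[OF kl(3)])
      show "\<rho> k \<oplus>\<^bsub>tensor_rmod A S C\<^esub> \<rho> l \<in> carrier (tensor_group A S C)"
        using tS.M.a_closed[of "\<rho> k" "\<rho> l"] \<rho> kl by simp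
      show "i (\<rho> k \<oplus>\<^bsub>tensor_rmod A S C\<^esub> \<rho> l) = coact M (k \<oplus>\<^bsub>S\<^esub> l)"
        using kl \<rho> rlinearD(2)[OF M.coact_rlinear] by (simp add: hom_mult[OF ihom] SM Kc)
    qed
  next
    fix k a assume "k \<in> carrier S" and a: "a \<in> carrier A"
    then have k: "k \<in> K" "k \<lhd>\<^bsub>S\<^esub> a \<in> K" using S.ract_closed carrier_S by auto
    show "\<rho> (k \<lhd>\<^bsub>S\<^esub> a) = \<rho> k \<lhd>\<^bsub>tensor_rmod A S C\<^esub> a"
    proof (rule rho_eq[OF k(2)])
      show "\<rho> k \<lhd>\<^bsub>tensor_rmod A S C\<^esub> a \<in> carrier (tensor_group A S C)"
        using tS.ract_closed[of "\<rho> k" a] \<rho> k a by simp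
      have "i (\<rho> k \<lhd>\<^bsub>tensor_rmod A S C\<^esub> a) = coact M k \<lhd>\<^bsub>tensor_rmod A M C\<^esub> a"
        using rlinearD(3)[OF ri, of "\<rho> k" a] \<rho>[OF k(1)] a by simp
      then show "i (\<rho> k \<lhd>\<^bsub>tensor_rmod A S C\<^esub> a) = coact M (k \<lhd>\<^bsub>S\<^esub> a)"
        using rlinearD(3)[OF M.coact_rlinear, of k a] k a by (simp add: SM Kc)
    qed
  qed
  let ?CC = "tensor_bimod A C C"
  interpret TS: tensor_triple A S C C by (intro tensor_triple.intro S bimod_C)
  interpret TM: tensor_triple A M C C by (intro tensor_triple.intro right_module_M bimod_C)
  note LS = TS.L.tensor_factors_axioms and LM = TM.L.tensor_factors_axioms
    and RS = TS.R.tensor_factors_axioms and RM = TM.R.tensor_factors_axioms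
  have coassoc: "tensor_assoc A S C C (tensor_map A S C (tensor_rmod A S C) C \<rho> (\<lambda>d. d) (\<rho> m)) =
      tensor_map A S C S ?CC (\<lambda>n. n) (comult C) (\<rho> m)" (is "tensor_assoc A S C C ?u = ?v")
    if m: "m \<in> K" for m
  proof -
    \<comment> \<open>Both sides are pushed into M \<otimes> (C \<otimes> C) along
      \<open>?j\<close>. There naturality of associativity and \<open>\<rho>\<close> being a lift
      turn the equation into coassociativity of M.\<close>
    let ?j = "tensor_map A S ?CC M ?CC (\<lambda>k. k) (\<lambda>c. c)"
    have u: "?u \<in> carrier TS.left_triple"
      by (rule tensor_map_closed[OF FS LS r\<rho> llinear_id \<rho>(1)[OF m]])
    have "?j (tensor_assoc A S C C ?u) =
        tensor_assoc A M C C (tensor_map A (tensor_rmod A S C) C (tensor_rmod A M C) C i (\<lambda>p. p) ?u)"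
      unfolding i_def by (rule tensor_assoc_natural[OF S right_module_M bimod_C bimod_C rS u, symmetric])
    also have "tensor_map A (tensor_rmod A S C) C (tensor_rmod A M C) C i (\<lambda>p. p) ?u =
        tensor_map A S C (tensor_rmod A M C) C (\<lambda>x. i (\<rho> x)) (\<lambda>d. d) (\<rho> m)"
      by (rule tensor_map_comp[OF FS LS LM r\<rho> llinear_id ri llinear_id \<rho>(1)[OF m]])
    also have "\<dots> = tensor_map A S C (tensor_rmod A M C) C (\<lambda>x. coact M x) (\<lambda>d. d) (\<rho> m)"
      by (rule fun_cong[OF tensor_map_cong]) (simp_all add: \<rho>(2) carrier_S)
    also have "\<dots> = tensor_map A M C (tensor_rmod A M C) C (coact M) (\<lambda>d. d) (i (\<rho> m))"
      unfolding i_def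
      by (rule tensor_map_comp[OF FS FM LM rS llinear_id M.coact_rlinear llinear_id \<rho>(1)[OF m], symmetric])
    also have "tensor_assoc A M C C \<dots> = tensor_map A M C M ?CC (\<lambda>n. n) (comult C) (i (\<rho> m))"
      unfolding \<rho>(2)[OF m] by (rule M.coact_coassoc[OF Kc[OF m]])
    also have "\<dots> = tensor_map A S C M ?CC (\<lambda>n. n) (comult C) (\<rho> m)"
      unfolding i_def
      by (rule tensor_map_comp[OF FS FM RM rS llinear_id rlinear_id llinear_comult \<rho>(1)[OF m]])
    also have "\<dots> = ?j ?v"
      by (rule tensor_map_comp[OF FS RS RM rlinear_id llinear_comult rS llinear_id \<rho>(1)[OF m], symmetric])
    finally have "?j (tensor_assoc A S C C ?u) = ?j ?v" .
    moreover have "tensor_assoc A S C C ?u \<in> carrier TS.right_triple"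
      using TS.tensor_assoc_hom u by (auto simp: hom_def)
    moreover have "?v \<in> carrier TS.right_triple"
      by (rule tensor_map_closed[OF FS RS rlinear_id llinear_comult \<rho>(1)[OF m]])
    ultimately show ?thesis
      using inj_K_CC[OF K, folded S_def] by (blast dest: inj_onD)
  qed
  have counit: "tensor_lift A S C (add_monoid S) (\<lambda>n d. n \<lhd>\<^bsub>S\<^esub> counit C d) (\<rho> m) = m"
    if m: "m \<in> K" for m
  proof -
    let ?l = "\<lambda>X. tensor_lift A X C (add_monoid X) (\<lambda>n d. n \<lhd>\<^bsub>X\<^esub> counit C d)"
    have sm: "(\<lambda>x. x) \<in> hom (add_monoid S) (add_monoid M)"
      using rS by (simp add: rlinear_def)
    \<comment> \<open>Contracting by the counit before or after enlarging K to M gives the same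
      element, as seen on pure tensors.\<close>
    have "?l S (\<rho> m) = ?l M (i (\<rho> m))"
    proof (rule SC.tensor_hom_eqI[OF hom_comp[OF counit_lift(1)[OF S] sm]
          hom_comp[OF ihom counit_lift(1)[OF right_module_M]]])
      fix n c assume nc: "n \<in> carrier S" "c \<in> carrier C"
      have "i (pure_tensor A S C n c) = pure_tensor A M C n c"
        unfolding i_def by (rule tensor_map_pure[OF FS FM rS llinear_id nc])
      then show "?l S (pure_tensor A S C n c) = ?l M (i (pure_tensor A S C n c))"
        using counit_lift(2)[OF S nc] counit_lift(2)[OF right_module_M rlinearD(1)[OF rS nc(1)] nc(2)]
        by (simp only: SM)
    qed (use \<rho>(1)[OF m] M.right.M.a_group in auto)
    then show ?thesis using M.coact_counit[OF Kc[OF m]] \<rho>(2)[OF m] by simp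
  qed
  note cong = tensor_cong[OF eqs] tensor_rmod_cong[OF eqs] tensor_assoc_cong[OF eqs]
  have rm: "right_module A S'" by (rule right_module_cong[OF S]) (simp_all add: eqs zS)
  have am: "add_monoid S' = add_monoid S" using eqs zS by simp
  have "right_comodule A C S'"
  proof (intro right_comodule.intro right_comodule_axioms.intro rm)
    show "rlinear A S' (tensor_rmod A S' C) (coact S')"
      using r\<rho> unfolding cong zS rlinear_def am eqs .
    show "tensor_assoc A S' C C (tensor_map A S' C (tensor_rmod A S' C) C (coact S') (\<lambda>d. d) (coact S' m)) =
        tensor_map A S' C S' ?CC (\<lambda>n. n) (comult C) (coact S' m)" if "m \<in> carrier S'" for m
      using coassoc[of m] that unfolding cong zS eqs carrier_S by blast
    show "tensor_lift A S' C (add_monoid S') (\<lambda>n d. n \<lhd>\<^bsub>S'\<^esub> counit C d) (coact S' m) = m"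
      if "m \<in> carrier S'" for m
      using counit[of m] that unfolding cong zS am eqs carrier_S by blast
  qed
  moreover have "(\<lambda>k\<in>K. k) \<in> comodule_hom A C S' M"
  proof -
    have "rlinear A S' M (\<lambda>k\<in>K. k)"
      by (rule rlinearI) (use M.right.submod_add[OF K] M.right.submod_ract[OF K] in \<open>auto simp: S'_def Kc\<close>)
    moreover have "tensor_map A S' C M C (\<lambda>k\<in>K. k) (\<lambda>c. c) (\<rho> m) = i (\<rho> m)" if "m \<in> K" for m
      unfolding cong i_def by (rule fun_cong[OF tensor_map_cong]) (simp_all add: carrier_S)
    ultimately show ?thesis
      unfolding comodule_hom_def by (simp add: eqs carrier_S zS \<rho>(2))
  qed
  ultimately show ?thesis
    unfolding subcomodule_def S'_def using M.right.submod_subset[OF K] by blast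
qed

text \<open>Colinearity of the inclusion writes the coaction of M at k as the image of the value
  \<open>\<rho> k\<close> of the coaction on K. Passing to the record without \<open>\<rho>\<close>
  is harmless by \<open>tensor_cong\<close>.\<close>

lemma subcomoduleD:
  assumes "subcomodule A C M K"
  shows "submod A M K" and "k \<in> K \<Longrightarrow> coact M k \<in> sub_tensor K"
proof -
  obtain \<rho> where K: "K \<subseteq> carrier M" and co: "right_comodule A C (M\<lparr>carrier := K, coact := \<rho>\<rparr>)"
    and h: "(\<lambda>k\<in>K. k) \<in> comodule_hom A C (M\<lparr>carrier := K, coact := \<rho>\<rparr>) M"
    using assms unfolding subcomodule_def by blast
  define S' where "S' = M\<lparr>carrier := K, coact := \<rho>\<rparr>"
  interpret S: right_comodule A C S' using co by (simp add: S'_def)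
  have s: "carrier S' = K" "ring.add S' = ring.add M" "ring.zero S' = ring.zero M" "ract S' = ract M" "coact S' = \<rho>"
    by (simp_all add: S'_def)
  show "submod A M K"
  proof (rule M.right.submodI[OF K])
    show "\<zero>\<^bsub>M\<^esub> \<in> K" using S.right.M.zero_closed s by simp
    show "x \<oplus>\<^bsub>M\<^esub> y \<in> K" if "x \<in> K" "y \<in> K" for x y using S.right.M.a_closed[of x y] that s by simp
    show "x \<lhd>\<^bsub>M\<^esub> a \<in> K" if "x \<in> K" "a \<in> carrier A" for x a
      using S.right.ract_closed[of x a] that s by simp
    show "\<ominus>\<^bsub>M\<^esub> x \<in> K" if x: "x \<in> K" for x
    proof -
      have "\<ominus>\<^bsub>S'\<^esub> x \<in> K" "\<ominus>\<^bsub>S'\<^esub> x \<oplus>\<^bsub>M\<^esub> x = \<zero>\<^bsub>M\<^esub>"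
        using S.right.M.a_inv_closed[of x] S.right.M.l_neg[of x] x s by auto
      then show ?thesis using M.right.M.minus_equality K x by (metis subsetD)
    qed
  qed
  have eqs: "carrier S' = carrier (M\<lparr>carrier := K\<rparr>)" "ring.add S' = ring.add (M\<lparr>carrier := K\<rparr>)"
    "ract S' = ract (M\<lparr>carrier := K\<rparr>)"
    by (simp_all add: S'_def)
  show "coact M k \<in> sub_tensor K" if k: "k \<in> K"
  proof (rule image_eqI)
    have "coact M k = tensor_map A S' C M C (\<lambda>k\<in>K. k) (\<lambda>c. c) (\<rho> k)"
      using h k unfolding comodule_hom_def S'_def[symmetric] by (simp add: s)
    also have "\<dots> = tensor_map A S' C M C (\<lambda>k. k) (\<lambda>c. c) (\<rho> k)"
      by (rule fun_cong[OF tensor_map_cong]) (simp_all add: s)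
    finally show "coact M k = tensor_map A (M\<lparr>carrier := K\<rparr>) C M C (\<lambda>k. k) (\<lambda>c. c) (\<rho> k)"
      unfolding tensor_cong[OF eqs] .
    show "\<rho> k \<in> carrier (tensor_group A (M\<lparr>carrier := K\<rparr>) C)"
      using rlinearD(1)[OF S.coact_rlinear, of k] k s unfolding tensor_cong[OF eqs, symmetric] by simp
  qed
qed

end

section \<open>The endomorphism ring\<close>

context flat_comodule
begin

abbreviation "End \<equiv> comodule_hom A C M M"
abbreviation "E \<equiv> endo_ring A C M"
abbreviation "map_C f \<equiv> tensor_map A M C M C f (\<lambda>c. c)"

lemma EndD:
  assumes "f \<in> End"
  shows "rlinear A M M f" and "f \<in> extensional (carrier M)"
    and "m \<in> carrier M \<Longrightarrow> f m \<in> carrier M"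
    and "m \<in> carrier M \<Longrightarrow> coact M (f m) = map_C f (coact M m)"
    and "f \<zero>\<^bsub>M\<^esub> = \<zero>\<^bsub>M\<^esub>"
    and "m \<in> carrier M \<Longrightarrow> f (\<ominus>\<^bsub>M\<^esub> m) = \<ominus>\<^bsub>M\<^esub> f m"
    and "\<lbrakk>x \<in> carrier M; y \<in> carrier M\<rbrakk> \<Longrightarrow> f (x \<oplus>\<^bsub>M\<^esub> y) = f x \<oplus>\<^bsub>M\<^esub> f y"
proof -
  show l: "rlinear A M M f" using assms by (simp add: comodule_hom_def)
  show "f \<in> extensional (carrier M)" "m \<in> carrier M \<Longrightarrow> coact M (f m) = map_C f (coact M m)"
    using assms by (simp_all add: comodule_hom_def)
  show "m \<in> carrier M \<Longrightarrow> f m \<in> carrier M" "f \<zero>\<^bsub>M\<^esub> = \<zero>\<^bsub>M\<^esub>"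
    "m \<in> carrier M \<Longrightarrow> f (\<ominus>\<^bsub>M\<^esub> m) = \<ominus>\<^bsub>M\<^esub> f m"
    "\<lbrakk>x \<in> carrier M; y \<in> carrier M\<rbrakk> \<Longrightarrow> f (x \<oplus>\<^bsub>M\<^esub> y) = f x \<oplus>\<^bsub>M\<^esub> f y"
    using rlinearD[OF l] rlinear_zero_minus[OF l M.right.M.abelian_group_axioms M.right.M.abelian_group_axioms]
    by auto
qed

text \<open>Endomorphisms are extensional, so each ring operation ends in a restriction. As f
  \<otimes> C depends on f on the carrier only, colinearity can be checked before
  restricting.\<close>

lemma End_restrictI:
  assumes "rlinear A M M f" "\<And>m. m \<in> carrier M \<Longrightarrow> coact M (f m) = map_C f (coact M m)"
  shows "restrict f (carrier M) \<in> End"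
proof -
  have "map_C (restrict f (carrier M)) = map_C f"
    by (rule tensor_map_cong) simp_all
  moreover have "rlinear A M M (restrict f (carrier M))"
    by (rule rlinearI) (simp_all add: rlinearD[OF assms(1)] M.right.ract_closed)
  ultimately show ?thesis using assms by (simp add: comodule_hom_def)
qed

lemma End_id: "(\<lambda>m\<in>carrier M. m) \<in> End"
  by (rule End_restrictI) (simp_all add: tensor_map_id[OF FM] coact_closed)

lemma End_comp: "\<lbrakk>f \<in> End; g \<in> End\<rbrakk> \<Longrightarrow> (\<lambda>m\<in>carrier M. g (f m)) \<in> End"
  by (rule End_restrictI)
    (simp_all add: rlinear_comp[OF EndD(1) EndD(1)] EndD tensor_map_comp[OF FM FM FM] coact_closed)

lemma End_add:
  assumes "f \<in> End" "g \<in> End"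
  shows "(\<lambda>m\<in>carrier M. f m \<oplus>\<^bsub>M\<^esub> g m) \<in> End"
proof (rule End_restrictI)
  show "rlinear A M M (\<lambda>m. f m \<oplus>\<^bsub>M\<^esub> g m)"
    by (rule rlinear_add[OF EndD(1)[OF assms(1)] EndD(1)[OF assms(2)] right_module_M])
  show "coact M (f m \<oplus>\<^bsub>M\<^esub> g m) = map_C (\<lambda>m. f m \<oplus>\<^bsub>M\<^esub> g m) (coact M m)" if "m \<in> carrier M" for m
    using that assms rlinearD(2)[OF M.coact_rlinear, of "f m" "g m"]
    by (simp add: EndD tensor_map_add_left[OF FM FM right_module_M] coact_closed)
qed

lemma End_zero: "(\<lambda>m\<in>carrier M. \<zero>\<^bsub>M\<^esub>) \<in> End"
  by (rule End_restrictI)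
    (auto intro!: rlinearI simp: M.right.zero_ract coact_zero tensor_map_zero[OF FM FM right_module_M] coact_closed)

text \<open>The maps (-f) \<otimes> C and f \<otimes> C add up to 0 \<otimes> C, which is trivial;
  so (-f) \<otimes> C gives the inverse of f \<otimes> C at the coaction, which is what colinearity
  of -f requires.\<close>

lemma End_minus:
  assumes f: "f \<in> End"
  shows "(\<lambda>m\<in>carrier M. \<ominus>\<^bsub>M\<^esub> f m) \<in> End"
proof (rule End_restrictI)
  show l: "rlinear A M M (\<lambda>m. \<ominus>\<^bsub>M\<^esub> f m)"
    by (rule rlinearI) (simp_all add: EndD[OF f] rlinearD(3)[OF EndD(1)[OF f]] M.right.minus_ract
        M.right.M.minus_add)
  fix m assume m: "m \<in> carrier M"
  interpret G: comm_group "tensor_group A M C" by (rule MC.comm_group_tensor)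
  have "map_C (\<lambda>m. \<ominus>\<^bsub>M\<^esub> f m) (coact M m) \<otimes>\<^bsub>tensor_group A M C\<^esub> map_C f (coact M m) =
      map_C (\<lambda>m. \<ominus>\<^bsub>M\<^esub> f m \<oplus>\<^bsub>M\<^esub> f m) (coact M m)"
    using tensor_map_add_left[OF FM FM right_module_M l EndD(1)[OF f] llinear_id coact_closed[OF m]] by simp
  also have "\<dots> = map_C (\<lambda>m. \<zero>\<^bsub>M\<^esub>) (coact M m)"
    by (rule fun_cong[OF tensor_map_cong]) (simp_all add: EndD[OF f] M.right.M.l_neg)
  also have "\<dots> = \<one>\<^bsub>tensor_group A M C\<^esub>"
    by (rule tensor_map_zero[OF FM FM right_module_M llinear_id coact_closed[OF m]])
  finally have "inv\<^bsub>tensor_group A M C\<^esub> (map_C f (coact M m)) = map_C (\<lambda>m. \<ominus>\<^bsub>M\<^esub> f m) (coact M m)"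
    by (rule G.inv_equality)
      (simp_all add: tensor_map_closed[OF FM FM] l EndD[OF f] coact_closed m)
  then show "coact M (\<ominus>\<^bsub>M\<^esub> f m) = map_C (\<lambda>m. \<ominus>\<^bsub>M\<^esub> f m) (coact M m)"
    using m by (simp add: coact_minus EndD[OF f])
qed

lemma E_simps [simp]:
  "carrier E = End" "f \<otimes>\<^bsub>E\<^esub> g = (\<lambda>m\<in>carrier M. g (f m))" "\<one>\<^bsub>E\<^esub> = (\<lambda>m\<in>carrier M. m)"
  "\<zero>\<^bsub>E\<^esub> = (\<lambda>m\<in>carrier M. \<zero>\<^bsub>M\<^esub>)" "f \<oplus>\<^bsub>E\<^esub> g = (\<lambda>m\<in>carrier M. f m \<oplus>\<^bsub>M\<^esub> g m)"
  by (simp_all add: endo_ring_def)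

lemma End_eqI:
  assumes "f \<in> End" "g \<in> End" "\<And>m. m \<in> carrier M \<Longrightarrow> f m = g m"
  shows "f = g"
  using EndD(2)[OF assms(1)] EndD(2)[OF assms(2)] assms(3) by (rule extensionalityI)

lemma ring_E: "ring E"
proof (rule ringI)
  show "abelian_group E"
  proof (rule abelian_groupI)
    fix f assume f: "f \<in> carrier E"
    then show "\<exists>g\<in>carrier E. g \<oplus>\<^bsub>E\<^esub> f = \<zero>\<^bsub>E\<^esub>"
      by (intro bexI[of _ "\<lambda>m\<in>carrier M. \<ominus>\<^bsub>M\<^esub> f m"])
        (auto intro!: restrict_ext simp: End_minus EndD M.right.M.l_neg)
  next
    fix f assume f: "f \<in> carrier E"
    have "\<zero>\<^bsub>E\<^esub> \<oplus>\<^bsub>E\<^esub> f \<in> End" using End_add[OF End_zero, of f] f by simp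
    then show "\<zero>\<^bsub>E\<^esub> \<oplus>\<^bsub>E\<^esub> f = f"
      using f by (intro End_eqI) (simp_all add: EndD)
  qed (auto intro!: restrict_ext simp: End_add End_zero EndD M.right.M.a_ac)
  show "monoid E"
  proof (rule monoidI)
    fix f assume f: "f \<in> carrier E"
    have "\<one>\<^bsub>E\<^esub> \<otimes>\<^bsub>E\<^esub> f \<in> End" "f \<otimes>\<^bsub>E\<^esub> \<one>\<^bsub>E\<^esub> \<in> End"
      using End_comp[OF End_id, of f] End_comp[OF _ End_id, of f] f by simp_all
    then show "\<one>\<^bsub>E\<^esub> \<otimes>\<^bsub>E\<^esub> f = f" "f \<otimes>\<^bsub>E\<^esub> \<one>\<^bsub>E\<^esub> = f"
      using f by (auto intro!: End_eqI simp: EndD simp del: restrict_apply) (simp_all add: EndD)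
  qed (auto intro!: restrict_ext simp: End_comp End_id EndD)
qed (auto intro!: restrict_ext simp: EndD)

lemma a_inv_E: "f \<in> End \<Longrightarrow> \<ominus>\<^bsub>E\<^esub> f = (\<lambda>m\<in>carrier M. \<ominus>\<^bsub>M\<^esub> f m)"
proof -
  interpret E: ring E by (rule ring_E)
  assume f: "f \<in> End"
  show ?thesis
    by (rule E.minus_equality)
      (use f in \<open>auto intro!: restrict_ext simp: End_minus EndD M.right.M.l_neg\<close>)
qed

lemma additive_subgroup_E:
  assumes "I \<subseteq> End" "(\<lambda>m\<in>carrier M. \<zero>\<^bsub>M\<^esub>) \<in> I"
    "\<And>f g. \<lbrakk>f \<in> I; g \<in> I\<rbrakk> \<Longrightarrow> (\<lambda>m\<in>carrier M. f m \<oplus>\<^bsub>M\<^esub> g m) \<in> I"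
    "\<And>f. f \<in> I \<Longrightarrow> (\<lambda>m\<in>carrier M. \<ominus>\<^bsub>M\<^esub> f m) \<in> I"
  shows "additive_subgroup I E"
proof (rule additive_subgroupI, rule subgroup.intro)
  show "inv\<^bsub>add_monoid E\<^esub> f \<in> I" if "f \<in> I" for f
    using a_inv_E[of f] assms(1) assms(4)[OF that] that by (simp add: a_inv_def subset_iff)
qed (use assms in auto)

section \<open>Annihilators and kernels\<close>

lemma An_iff: "f \<in> An A C M K \<longleftrightarrow> f \<in> End \<and> (\<forall>k\<in>K. f k = \<zero>\<^bsub>M\<^esub>)"
  by (simp add: An_def)

lemma right_ideal_An:
  assumes "K \<subseteq> carrier M"
  shows "right_ideal E (An A C M K)"
  unfolding right_ideal_def
proof (intro conjI ballI)
  show "additive_subgroup (An A C M K) E"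
    using assms by (intro additive_subgroup_E)
      (auto simp: An_iff End_zero End_add End_minus subset_iff)
  show "f \<otimes>\<^bsub>E\<^esub> g \<in> An A C M K" if "f \<in> An A C M K" "g \<in> carrier E" for f g
    using assms that by (auto simp: An_iff End_comp EndD subset_iff)
qed

text \<open>In a product the left factor acts first. Multiplying an annihilating f on the right
  therefore composes g with zero on K, whereas multiplying on the left feeds f with g k, which full
  invariance keeps in K.\<close>

lemma ideal_An:
  assumes "fully_invariant A C M K"
  shows "ideal (An A C M K) E"
proof -
  have K: "K \<subseteq> carrier M" "\<And>f k. \<lbrakk>f \<in> End; k \<in> K\<rbrakk> \<Longrightarrow> f k \<in> K"
    using assms unfolding fully_invariant_def subcomodule_def by blast+
  note r = right_ideal_An[OF K(1), unfolded right_ideal_def]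
  show ?thesis
  proof (rule idealI[OF ring_E])
    show "subgroup (An A C M K) (add_monoid E)"
      using additive_subgroup.a_subgroup r by blast
    show "g \<otimes>\<^bsub>E\<^esub> f \<in> An A C M K" if "f \<in> An A C M K" "g \<in> carrier E" for f g
      using K that by (auto simp: An_iff End_comp subset_iff)
  qed (use r in blast)
qed

lemma right_ideal_ideal: "ideal I E \<Longrightarrow> right_ideal E I"
  unfolding right_ideal_def by (simp add: ideal.axioms(1) ideal.I_r_closed del: E_simps)

text \<open>The annihilator of Ke F is a right ideal containing F, so it contains the right ideal
  generated by F. This replaces an infinite intersection of kernels by a finite one when F is
  finite.\<close>

lemma Ke_gen_right_ideal:
  assumes "F \<subseteq> End"
  shows "Ke M (gen_right_ideal E F) = Ke M F"
proof
  have "F \<subseteq> gen_right_ideal E F" unfolding gen_right_ideal_def by blast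
  then show "Ke M (gen_right_ideal E F) \<subseteq> Ke M F" unfolding Ke_def by blast
  have "gen_right_ideal E F \<subseteq> An A C M (Ke M F)"
    unfolding gen_right_ideal_def
    using right_ideal_An[of "Ke M F"] assms by (intro Inter_lower) (auto simp: An_iff Ke_def)
  then show "Ke M F \<subseteq> Ke M (gen_right_ideal E F)" by (auto simp: An_iff Ke_def subset_iff)
qed

lemma subcomodule_subset: "subcomodule A C M K \<Longrightarrow> K \<subseteq> carrier M"
  unfolding subcomodule_def by blast

lemma subcomodule_carrier: "subcomodule A C M (carrier M)"
proof (rule subcomoduleI[OF M.right.submod_carrier])
  fix k assume "k \<in> carrier M"
  then show "coact M k \<in> sub_tensor (carrier M)"
    by (intro image_eqI[of _ _ "coact M k"]) (simp_all add: tensor_map_id[OF FM] coact_closed)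
qed

text \<open>Taking the kernel inside a subcomodule L allows induction on a finite set of maps. For k
  in the kernel, lift its coaction to L \<otimes> C; colinearity shows that f \<otimes> C kills the
  lift, and exactness moves it into the kernel tensored with C.\<close>

lemma subcomodule_kernel:
  assumes L: "subcomodule A C M L" and f: "f \<in> End"
  shows "subcomodule A C M {x \<in> L. f x = \<zero>\<^bsub>M\<^esub>}"
proof -
  let ?K = "{x \<in> L. f x = \<zero>\<^bsub>M\<^esub>}" and ?L = "M\<lparr>carrier := L\<rparr>"
  note sL = subcomoduleD(1)[OF L]
  note rL = right_module_K[OF sL] and iL = rlinear_K[OF sL]
  note FL = tensor_factors_C[OF rL]
  have Lc: "x \<in> carrier M" if "x \<in> L" for x using that subcomodule_subset[OF L] by blast
  have sK: "submod A M ?K"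
    by (rule M.right.submodI)
      (auto simp: Lc EndD[OF f] M.right.submod_zero[OF sL] M.right.submod_add[OF sL]
        M.right.submod_minus[OF sL] M.right.submod_ract[OF sL] rlinearD(3)[OF EndD(1)[OF f]] M.right.zero_ract)
  note FK = tensor_factors_C[OF right_module_K[OF sK]]
  have fL: "rlinear A ?L M f"
    using rlinear_comp[OF iL EndD(1)[OF f]] .
  have KL: "rlinear A (M\<lparr>carrier := ?K\<rparr>) ?L (\<lambda>x. x)" by (rule rlinearI) simp_all
  show ?thesis
  proof (rule subcomoduleI[OF sK])
    fix k assume k: "k \<in> ?K"
    then obtain s where s: "s \<in> carrier (tensor_group A ?L C)"
      "coact M k = tensor_map A ?L C M C (\<lambda>k. k) (\<lambda>c. c) s"
      using subcomoduleD(2)[OF L, of k] by blast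
    have "tensor_map A ?L C M C f (\<lambda>c. c) s = map_C f (coact M k)"
      unfolding s(2) by (rule tensor_map_comp[OF FL FM FM iL llinear_id EndD(1)[OF f] llinear_id s(1), symmetric])
    also have "\<dots> = coact M \<zero>\<^bsub>M\<^esub>" using k EndD(4)[OF f, of k] Lc by simp
    finally have "tensor_map A ?L C M C f (\<lambda>c. c) s = \<one>\<^bsub>tensor_group A M C\<^esub>" by (simp add: coact_zero)
    from tensor_kernel_image[OF flat bimod_C rL right_module_M fL s(1) this]
    obtain u where u: "u \<in> carrier (tensor_group A (M\<lparr>carrier := ?K\<rparr>) C)"
      "s = tensor_map A (M\<lparr>carrier := ?K\<rparr>) C ?L C (\<lambda>x. x) (\<lambda>n. n) u"
      by auto
    have "coact M k = tensor_map A (M\<lparr>carrier := ?K\<rparr>) C M C (\<lambda>k. k) (\<lambda>c. c) u"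
      unfolding s(2) u(2) by (rule tensor_map_comp[OF FK FL FM KL llinear_id iL llinear_id u(1)])
    with u(1) show "coact M k \<in> sub_tensor ?K" by blast
  qed
qed

lemma subcomodule_Ke_finite:
  assumes "finite F" "F \<subseteq> End"
  shows "subcomodule A C M (Ke M F)"
  using assms
proof (induction F rule: finite_induct)
  case empty
  then show ?case using subcomodule_carrier by (simp add: Ke_def)
next
  case (insert f F)
  have "Ke M (insert f F) = {x \<in> Ke M F. f x = \<zero>\<^bsub>M\<^esub>}" by (auto simp: Ke_def)
  then show ?case using insert subcomodule_kernel[of "Ke M F" f] by simp
qed

lemma subcomodule_Ke:
  assumes "fg_right_ideal E I"
  shows "subcomodule A C M (Ke M I)"
  using assms subcomodule_Ke_finite unfolding fg_right_ideal_def by (auto simp: Ke_gen_right_ideal)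

section \<open>Sums of subcomodules\<close>

lemma sub_tensor_subgroup:
  assumes "submod A M K"
  shows "subgroup (sub_tensor K) (tensor_group A M C)"
proof -
  note FK = tensor_factors_C[OF right_module_K[OF assms]]
  interpret group_hom "tensor_group A (M\<lparr>carrier := K\<rparr>) C" "tensor_group A M C"
    "tensor_map A (M\<lparr>carrier := K\<rparr>) C M C (\<lambda>k. k) (\<lambda>c. c)"
    using tensor_map_hom(1)[OF FK FM rlinear_K[OF assms] llinear_id] tensor_factors.group_tensor[OF FK] group_MC
    by (simp add: group_hom.intro group_hom_axioms.intro)
  show ?thesis by (rule img_is_subgroup)
qed

lemma sub_tensor_mono:
  assumes "submod A M K" "submod A M L" "K \<subseteq> L"
  shows "sub_tensor K \<subseteq> sub_tensor L"
proof
  fix t assume "t \<in> sub_tensor K"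
  then obtain s where s: "s \<in> carrier (tensor_group A (M\<lparr>carrier := K\<rparr>) C)"
    "t = tensor_map A (M\<lparr>carrier := K\<rparr>) C M C (\<lambda>k. k) (\<lambda>c. c) s" by blast
  have KL: "rlinear A (M\<lparr>carrier := K\<rparr>) (M\<lparr>carrier := L\<rparr>) (\<lambda>x. x)"
    by (rule rlinearI) (use assms(3) in auto)
  note FK = tensor_factors_C[OF right_module_K[OF assms(1)]]
  note FL = tensor_factors_C[OF right_module_K[OF assms(2)]]
  have "t = tensor_map A (M\<lparr>carrier := L\<rparr>) C M C (\<lambda>k. k) (\<lambda>c. c)
      (tensor_map A (M\<lparr>carrier := K\<rparr>) C (M\<lparr>carrier := L\<rparr>) C (\<lambda>k. k) (\<lambda>c. c) s)"
    unfolding s(2)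
    by (rule tensor_map_comp[OF FK FL FM KL llinear_id rlinear_K[OF assms(2)] llinear_id s(1), symmetric])
  then show "t \<in> sub_tensor L"
    using tensor_map_closed[OF FK FL KL llinear_id s(1)] by blast
qed

text \<open>Membership of the coaction in the image of S \<otimes> C is stable under sums and
  negatives because that image is a subgroup; so it suffices to have it on each member of the
  family, where monotonicity gives it. The empty family yields the zero subcomodule.\<close>

lemma subcomodule_sum:
  assumes "\<And>K. K \<in> \<K> \<Longrightarrow> subcomodule A C M K"
  shows "subcomodule A C M (generate (add_monoid M) (\<Union>\<K>))"
proof -
  define S where "S = generate (add_monoid M) (\<Union>\<K>)"
  have sub: "\<Union>\<K> \<subseteq> carrier (add_monoid M)" using assms subcomodule_subset by auto
  have S: "subgroup S (add_monoid M)"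
    unfolding S_def by (rule group.generate_is_subgroup[OF M.right.M.a_group sub])
  have "k \<lhd>\<^bsub>M\<^esub> a \<in> S" if "k \<in> S" "a \<in> carrier A" for k a
    using that(1) unfolding S_def
  proof (induction rule: generate.induct)
    case one
    then show ?case using that(2) generate.one[of "add_monoid M"] by (simp add: M.right.zero_ract)
  next
    case (incl h)
    then show ?case using M.right.submod_ract subcomoduleD(1)[OF assms] that(2)
      by (meson UnionE UnionI generate.incl)
  next
    case (inv h)
    then obtain K where "K \<in> \<K>" "h \<in> K" by blast
    then have "h \<in> carrier M" "h \<lhd>\<^bsub>M\<^esub> a \<in> \<Union>\<K>"
      using M.right.submod_ract[OF subcomoduleD(1)[OF assms] _ that(2), of K h] sub by auto
    then show ?case
      using generate.inv[of "h \<lhd>\<^bsub>M\<^esub> a" "\<Union>\<K>" "add_monoid M"] M.right.minus_ract[of h a] that(2)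
      by (simp add: a_inv_def)
  next
    case (eng h1 h2)
    then have "h1 \<in> carrier M" "h2 \<in> carrier M"
      using group.generate_in_carrier[OF M.right.M.a_group sub] by auto
    then show ?case
      using generate.eng[OF eng(3,4)] that(2) by (simp add: M.right.ract_add_left)
  qed
  then have sS: "submod A M S" using S by (simp add: submod_def)
  interpret G: subgroup "sub_tensor S" "tensor_group A M C" by (rule sub_tensor_subgroup[OF sS])
  have "coact M k \<in> sub_tensor S" if "k \<in> S" for k
    using that[unfolded S_def]
  proof (induction rule: generate.induct)
    case one
    then show ?case using G.one_closed by (simp add: coact_zero)
  next
    case (incl h)
    then obtain K where K: "K \<in> \<K>" "h \<in> K" by blast
    then have "K \<subseteq> S" unfolding S_def by (auto intro: generate.incl)
    then show ?case
      using subcomoduleD[OF assms[OF K(1)]] K(2) sub_tensor_mono[OF _ sS] by blast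
  next
    case (inv h)
    then obtain K where K: "K \<in> \<K>" "h \<in> K" by blast
    then have "K \<subseteq> S" unfolding S_def by (auto intro: generate.incl)
    then have "coact M h \<in> sub_tensor S"
      using subcomoduleD[OF assms[OF K(1)]] K(2) sub_tensor_mono[OF _ sS] by blast
    then have "inv\<^bsub>tensor_group A M C\<^esub> coact M h \<in> sub_tensor S" by (rule G.m_inv_closed)
    then show ?case using coact_minus[of h] sub inv by (auto simp: a_inv_def)
  next
    case (eng h1 h2)
    then have "h1 \<in> carrier M" "h2 \<in> carrier M"
      using group.generate_in_carrier[OF M.right.M.a_group sub] by auto
    then show ?case
      using G.m_closed[OF eng(3,4)[unfolded S_def[symmetric]]] rlinearD(2)[OF M.coact_rlinear] by simp
  qed
  then show ?thesis using subcomoduleI[OF sS] unfolding S_def by blast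
qed

end

section \<open>Factor comodules and fully coprime subcomodules\<close>

context flat_comodule
begin

section \<open>The factor comodule and maps from it to M\<close>

context
  fixes K assumes K: "subcomodule A C M K"
begin

abbreviation "Q \<equiv> factor_rmodule M K"
abbreviation "proj m \<equiv> K +>\<^bsub>M\<^esub> m"

lemma abelian_subgroup_K: "abelian_subgroup K M"
  using subcomoduleD(1)[OF K] M.right.M.abelian_group_axioms
  by (simp add: submod_def abelian_subgroupI3 additive_subgroupI)

interpretation KM: abelian_subgroup K M by (rule abelian_subgroup_K)

lemma proj_eq_iff:
  assumes "x \<in> carrier M" "y \<in> carrier M"
  shows "proj x = proj y \<longleftrightarrow> x \<ominus>\<^bsub>M\<^esub> y \<in> K"
proof -
  have "x \<in> proj y \<longleftrightarrow> proj x = proj y"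
    using M.right.M.a_repr_independence[OF _ assms(2) KM.a_subgroup] KM.a_rcos_self[OF assms(1)] by metis
  then show ?thesis using KM.a_rcos_module[OF assms(2,1)] by (simp add: a_minus_def)
qed

lemma factor_carrier: "carrier Q = proj ` carrier M"
  by (auto simp: factor_rmodule_def A_RCOSETS_def')

lemma proj_add: "\<lbrakk>x \<in> carrier M; y \<in> carrier M\<rbrakk> \<Longrightarrow> proj x \<oplus>\<^bsub>Q\<^esub> proj y = proj (x \<oplus>\<^bsub>M\<^esub> y)"
  by (simp add: factor_rmodule_def KM.a_rcos_sum)

lemma proj_memD: "\<lbrakk>x \<in> proj m; m \<in> carrier M\<rbrakk> \<Longrightarrow> x \<in> carrier M \<and> proj x = proj m"
  using M.right.M.a_repr_independence[OF _ _ KM.a_subgroup] KM.a_elemrcos_carrier by metis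

text \<open>The action on cosets is a union over all representatives; they yield one and the same
  coset, since K is closed under the action, and the union is over a nonempty set.\<close>

lemma proj_ract:
  assumes "m \<in> carrier M" "a \<in> carrier A"
  shows "proj m \<lhd>\<^bsub>Q\<^esub> a = proj (m \<lhd>\<^bsub>M\<^esub> a)"
proof -
  have "proj (x \<lhd>\<^bsub>M\<^esub> a) = proj (m \<lhd>\<^bsub>M\<^esub> a)" if "x \<in> proj m" for x
  proof -
    have x: "x \<in> carrier M" "x \<ominus>\<^bsub>M\<^esub> m \<in> K"
      using proj_memD[OF that assms(1)] proj_eq_iff assms(1) by auto
    have "x \<lhd>\<^bsub>M\<^esub> a \<ominus>\<^bsub>M\<^esub> m \<lhd>\<^bsub>M\<^esub> a = (x \<ominus>\<^bsub>M\<^esub> m) \<lhd>\<^bsub>M\<^esub> a"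
      using x assms by (simp add: a_minus_def M.right.ract_add_left M.right.minus_ract)
    then show ?thesis
      using x assms M.right.submod_ract[OF subcomoduleD(1)[OF K] x(2) assms(2)]
      by (subst proj_eq_iff) (simp_all add: M.right.ract_closed)
  qed
  then have "(\<Union>x\<in>proj m. proj (x \<lhd>\<^bsub>M\<^esub> a)) = (\<Union>x\<in>proj m. proj (m \<lhd>\<^bsub>M\<^esub> a))"
    by (intro SUP_cong refl)
  also have "\<dots> = proj (m \<lhd>\<^bsub>M\<^esub> a)"
    using KM.a_rcos_self[OF assms(1)] by blast
  finally show ?thesis by (simp add: factor_rmodule_def)
qed

lemma right_module_factor: "right_module A Q"
proof -
  interpret Q: abelian_group Q
    by (rule abelian_groupI'[OF KM.a_factorgroup_is_comm_group])
      (simp_all add: factor_rmodule_def A_FactGroup_def')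
  show ?thesis
    by unfold_locales
      (auto simp: factor_carrier proj_add proj_ract M.right.ract_closed M.right.ract_add_left
        M.right.ract_add_right M.right.ract_assoc M.right.ract_one)
qed

lemma rlinear_proj: "rlinear A M Q proj"
  by (rule rlinearI) (auto simp: factor_carrier proj_add proj_ract)

text \<open>The difference x - y lies in K, so its coaction comes from K \<otimes> C, where the
  projection tensored with C is zero. This is the independence of representatives behind the
  definite description in the factor coaction.\<close>

lemma tensor_proj_eq:
  assumes "x \<in> carrier M" "y \<in> carrier M" "proj x = proj y"
  shows "tensor_map A M C Q C proj (\<lambda>c. c) (coact M x) = tensor_map A M C Q C proj (\<lambda>c. c) (coact M y)"
proof -
  note FQ = tensor_factors_C[OF right_module_factor]
  interpret QC: tensor_factors A Q C by (rule FQ)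
  note sK = subcomoduleD(1)[OF K]
  note FK = tensor_factors_C[OF right_module_K[OF sK]]
  have k: "x \<ominus>\<^bsub>M\<^esub> y \<in> K" using assms proj_eq_iff by simp
  obtain s where s: "s \<in> carrier (tensor_group A (M\<lparr>carrier := K\<rparr>) C)"
    "coact M (x \<ominus>\<^bsub>M\<^esub> y) = tensor_map A (M\<lparr>carrier := K\<rparr>) C M C (\<lambda>k. k) (\<lambda>c. c) s"
    using subcomoduleD(2)[OF K k] by blast
  have z: "proj k = \<zero>\<^bsub>Q\<^esub>" if "k \<in> K" for k
    using M.right.M.a_coset_join2[OF _ KM.a_subgroup that] that M.right.submod_subset[OF sK]
    by (auto simp: factor_rmodule_def)
  have "coact M x \<otimes>\<^bsub>tensor_group A M C\<^esub> inv\<^bsub>tensor_group A M C\<^esub> coact M y = coact M (x \<ominus>\<^bsub>M\<^esub> y)"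
    using assms rlinearD(2)[OF M.coact_rlinear, of x "\<ominus>\<^bsub>M\<^esub> y"] by (simp add: a_minus_def coact_minus)
  then have "tensor_map A M C Q C proj (\<lambda>c. c)
      (coact M x \<otimes>\<^bsub>tensor_group A M C\<^esub> inv\<^bsub>tensor_group A M C\<^esub> coact M y) =
      tensor_map A (M\<lparr>carrier := K\<rparr>) C Q C proj (\<lambda>c. c) s"
    using tensor_map_comp[OF FK FM FQ rlinear_K[OF sK] llinear_id rlinear_proj llinear_id s(1)] s(2) by simp
  also have "\<dots> = tensor_map A (M\<lparr>carrier := K\<rparr>) C Q C (\<lambda>k. \<zero>\<^bsub>Q\<^esub>) (\<lambda>c. c) s"
    by (rule fun_cong[OF tensor_map_cong]) (simp_all add: z)
  also have "\<dots> = \<one>\<^bsub>tensor_group A Q C\<^esub>"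
    by (rule tensor_map_zero[OF FK FQ right_module_factor llinear_id s(1)])
  finally show ?thesis
    using hom_diff_one_iff[OF tensor_map_hom(1)[OF FM FQ rlinear_proj llinear_id] group_MC QC.group_tensor]
      coact_closed assms by blast
qed

lemma factor_comodule_simps:
  "carrier (factor_comodule A C M K) = carrier Q" "ring.add (factor_comodule A C M K) = ring.add Q"
  "ring.zero (factor_comodule A C M K) = ring.zero Q" "ract (factor_comodule A C M K) = ract Q"
  by (simp_all add: factor_comodule_def Let_def)

lemma coact_factor:
  assumes "m \<in> carrier M"
  shows "coact (factor_comodule A C M K) (proj m) = tensor_map A M C Q C proj (\<lambda>c. c) (coact M m)"
proof -
  have e: "tensor_map A M C Q C proj (\<lambda>c. c) (coact M m) = tensor_map A M C Q C proj (\<lambda>c. c) (coact M x)"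
    if "x \<in> proj m" for x
    using tensor_proj_eq[of m x] proj_memD[OF that assms] assms by simp
  have "coact (factor_comodule A C M K) (proj m) =
      (THE t. \<forall>x\<in>proj m. t = tensor_map A M C Q C proj (\<lambda>c. c) (coact M x))"
    by (simp only: factor_comodule_def Let_def comodule.simps)
  also have "\<dots> = tensor_map A M C Q C proj (\<lambda>c. c) (coact M m)"
    by (rule the_equality) (use e KM.a_rcos_self[OF assms] in blast)+
  finally show ?thesis .
qed

text \<open>Turns test maps on M/K into members of An K, so that the self-cogenerator condition,
  which speaks of M/K, can be read inside E.\<close>

lemma End_factor:
  assumes h: "h \<in> comodule_hom A C (factor_comodule A C M K) M"
  shows "(\<lambda>m\<in>carrier M. h (proj m)) \<in> An A C M K"
proof -
  let ?P = "factor_comodule A C M K"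
  have hl: "rlinear A Q M h"
    using h unfolding comodule_hom_def rlinear_def hom_def by (simp add: factor_comodule_simps)
  have hc: "coact M (h X) = tensor_map A Q C M C h (\<lambda>c. c) (coact ?P X)" if "X \<in> carrier Q" for X
    using h that unfolding comodule_hom_def tensor_cong[OF factor_comodule_simps(1,2,4)]
    by (simp add: factor_comodule_simps)
  note FQ = tensor_factors_C[OF right_module_factor]
  have "(\<lambda>m\<in>carrier M. h (proj m)) \<in> End"
  proof (rule End_restrictI[OF rlinear_comp[OF rlinear_proj hl]])
    fix m assume m: "m \<in> carrier M"
    then have "proj m \<in> carrier Q" by (simp add: factor_carrier)
    then show "coact M (h (proj m)) = map_C (\<lambda>x. h (proj x)) (coact M m)"
      using tensor_map_comp[OF FM FQ FM rlinear_proj llinear_id hl llinear_id coact_closed[OF m]]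
      by (simp add: hc coact_factor[OF m])
  qed
  moreover have "h (proj k) = \<zero>\<^bsub>M\<^esub>" if "k \<in> K" for k
  proof -
    interpret Q: right_module A Q by (rule right_module_factor)
    have "proj k = \<zero>\<^bsub>Q\<^esub>"
      using M.right.M.a_coset_join2[OF _ KM.a_subgroup that] that subcomodule_subset[OF K]
      by (auto simp: factor_rmodule_def)
    then show ?thesis
      using rlinear_zero_minus(1)[OF hl Q.M.abelian_group_axioms M.right.M.abelian_group_axioms] by simp
  qed
  ultimately show ?thesis using subcomodule_subset[OF K] by (auto simp: An_iff)
qed

lemma Ke_An:
  assumes "self_cogenerator A C M"
  shows "Ke M (An A C M K) = K"
proof
  show "K \<subseteq> Ke M (An A C M K)"
    using subcomodule_subset[OF K] by (auto simp: Ke_def An_iff)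
  show "Ke M (An A C M K) \<subseteq> K"
  proof
    fix m assume m: "m \<in> Ke M (An A C M K)"
    then have mM: "m \<in> carrier M" by (simp add: Ke_def)
    have "h (proj m) = \<zero>\<^bsub>M\<^esub>" if "h \<in> comodule_hom A C (factor_comodule A C M K) M" for h
      using m End_factor[OF that] mM by (auto simp: Ke_def)
    moreover have "proj m \<in> carrier (factor_comodule A C M K)"
      using mM by (simp add: factor_comodule_simps factor_carrier)
    ultimately have "proj m = \<zero>\<^bsub>factor_comodule A C M K\<^esub>"
      using assms K unfolding self_cogenerator_def by blast
    then show "m \<in> K"
      using M.right.M.a_coset_join1[OF _ mM KM.a_subgroup]
      by (simp add: factor_comodule_simps factor_rmodule_def)
  qed
qed

end

lemma fully_invariant_Ke:
  assumes "ideal I E" "fg_right_ideal E I"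
  shows "fully_invariant A C M (Ke M I)"
  unfolding fully_invariant_def
proof (intro conjI ballI subsetI)
  show "subcomodule A C M (Ke M I)" by (rule subcomodule_Ke[OF assms(2)])
  fix f y assume f: "f \<in> End" and "y \<in> f ` Ke M I"
  then obtain m where m: "m \<in> carrier M" "\<And>g. g \<in> I \<Longrightarrow> g m = \<zero>\<^bsub>M\<^esub>" "y = f m"
    by (auto simp: Ke_def)
  \<comment> \<open>With f arbitrary in E and g in I, the composite m \<mapsto> g (f m) is the
    product f g, which lies in I by closure under left multiplication.\<close>
  have "g (f m) = \<zero>\<^bsub>M\<^esub>" if "g \<in> I" for g
    using m(2)[OF ideal.I_l_closed[OF assms(1) that, of f]] f m(1) by simp
  then show "y \<in> Ke M I" using m f by (simp add: Ke_def EndD)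
qed

section \<open>Prime ideals correspond to fully coprime subcomodules\<close>

context
  assumes inj: "intrinsically_injective A C M"
    and cogen: "self_cogenerator A C M"
    and noeth: "right_noetherian E"
begin

lemma An_Ke: "right_ideal E I \<Longrightarrow> An A C M (Ke M I) = I"
  using inj noeth unfolding intrinsically_injective_def right_noetherian_def by blast

lemma ideal_fully_invariant: "ideal I E \<Longrightarrow> fully_invariant A C M (Ke M I)"
  using fully_invariant_Ke right_ideal_ideal noeth unfolding right_noetherian_def by blast

text \<open>Coprimeness is tested on X = Ke I and Y = Ke J. By the double annihilator property the
  maps killing Ke I are those of I, so K \<subseteq> (X : Y) only asks that g (f k) = 0 for f in I
  and g in J.\<close>

lemma prime_ideal_An:
  assumes "fully_coprime A C M K"
  shows "prime_ideal E (An A C M K)"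
proof -
  have K: "fully_invariant A C M K" "K \<noteq> {\<zero>\<^bsub>M\<^esub>}" "subcomodule A C M K"
    "\<And>X Y. \<lbrakk>fully_invariant A C M X; fully_invariant A C M Y; K \<subseteq> colon A C M X Y\<rbrakk> \<Longrightarrow> K \<subseteq> X \<or> K \<subseteq> Y"
    using assms unfolding fully_coprime_def fully_invariant_def by blast+
  note KM = subcomodule_subset[OF K(3)]
  show ?thesis
    unfolding prime_ideal_def
  proof (intro conjI allI impI)
    show "ideal (An A C M K) E" by (rule ideal_An[OF K(1)])
    \<comment> \<open>A nonzero element of K keeps the identity out of An K, so the ideal is
      proper.\<close>
    obtain k where "k \<in> K" "k \<noteq> \<zero>\<^bsub>M\<^esub>"
      using K(2) M.right.submod_zero[OF subcomoduleD(1)[OF K(3)]] by blast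
    then have "(\<lambda>m\<in>carrier M. m) \<notin> An A C M K" using KM by (auto simp: An_iff)
    then show "An A C M K \<noteq> carrier E" using End_id by auto
  next
    fix I J assume "ideal I E \<and> ideal J E \<and> ideal_prod E I J \<subseteq> An A C M K"
    then have I: "ideal I E" and J: "ideal J E" and IJ: "ideal_prod E I J \<subseteq> An A C M K" by auto
    have "K \<subseteq> colon A C M (Ke M I) (Ke M J)"
    proof
      fix k assume k: "k \<in> K"
      then have kM: "k \<in> carrier M" using KM by blast
      have "f k \<in> Ke M J" if f: "f \<in> End" "\<forall>x\<in>Ke M I. f x = \<zero>\<^bsub>M\<^esub>" for f
      proof -
        have "f \<in> I" using f An_Ke[OF right_ideal_ideal[OF I]] by (auto simp: An_iff)
        then have "f \<otimes>\<^bsub>E\<^esub> g \<in> An A C M K" if "g \<in> J" for g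
          using subsetD[OF IJ ideal_prod.prod[OF _ that]] by blast
        then have fg: "(f \<otimes>\<^bsub>E\<^esub> g) k = \<zero>\<^bsub>M\<^esub>" if "g \<in> J" for g
          using that k unfolding An_iff by blast
        have "g (f k) = \<zero>\<^bsub>M\<^esub>" if "g \<in> J" for g
          using fg[OF that] kM by simp
        then show ?thesis using f(1) kM by (simp add: Ke_def EndD)
      qed
      then show "k \<in> colon A C M (Ke M I) (Ke M J)" using kM by (simp add: colon_def)
    qed
    then have "K \<subseteq> Ke M I \<or> K \<subseteq> Ke M J"
      using K(4) ideal_fully_invariant I J by blast
    \<comment> \<open>Containment of subcomodules is reversed by An, and An (Ke L) is L
      again.\<close>
    moreover have "L \<subseteq> An A C M K" if "ideal L E" "K \<subseteq> Ke M L" for L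
    proof -
      have "An A C M (Ke M L) \<subseteq> An A C M K" using that(2) unfolding An_def by blast
      then show ?thesis by (simp only: An_Ke[OF right_ideal_ideal[OF that(1)]])
    qed
    ultimately show "I \<subseteq> An A C M K \<or> J \<subseteq> An A C M K" using I J by blast
  qed
qed

text \<open>Primeness is tested on I = An X and J = An Y, and the resulting inclusions of ideals are
  reversed by Ke, where Ke (An Z) = Z returns X or Y.\<close>

lemma fully_coprime_Ke:
  assumes P: "prime_ideal E P"
  shows "fully_coprime A C M (Ke M P)"
proof -
  have id: "ideal P E" "P \<noteq> carrier E"
    "\<And>I J. \<lbrakk>ideal I E; ideal J E; ideal_prod E I J \<subseteq> P\<rbrakk> \<Longrightarrow> I \<subseteq> P \<or> J \<subseteq> P"
    using P unfolding prime_ideal_def by auto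
  note AP = An_Ke[OF right_ideal_ideal[OF id(1)]]
  show ?thesis
    unfolding fully_coprime_def
  proof (intro conjI allI impI)
    show "fully_invariant A C M (Ke M P)" by (rule ideal_fully_invariant[OF id(1)])
    show "Ke M P \<noteq> {\<zero>\<^bsub>M\<^esub>}"
    proof
      assume "Ke M P = {\<zero>\<^bsub>M\<^esub>}"
      \<comment> \<open>Every endomorphism kills 0, so Ke P = 0 would force P = An (Ke P) to be the
        whole ring.\<close>
      then have "End \<subseteq> An A C M (Ke M P)" by (auto simp: An_iff EndD)
      moreover have "An A C M (Ke M P) \<subseteq> End" by (auto simp: An_iff)
      ultimately show False using id(2) AP by simp
    qed
  next
    fix X Y assume "fully_invariant A C M X \<and> fully_invariant A C M Y \<and> Ke M P \<subseteq> colon A C M X Y"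
    then have X: "fully_invariant A C M X" and Y: "fully_invariant A C M Y"
      and c: "Ke M P \<subseteq> colon A C M X Y" by auto
    interpret E: ring E by (rule ring_E)
    have "ideal_prod E (An A C M X) (An A C M Y) \<subseteq> An A C M (Ke M P)"
    proof
      fix s assume "s \<in> ideal_prod E (An A C M X) (An A C M Y)"
      then show "s \<in> An A C M (Ke M P)"
      proof (induction rule: ideal_prod.induct)
        case (prod f g)
        \<comment> \<open>As f kills X and k lies in the colon, f k is in Y, and g kills Y.\<close>
        have "g (f k) = \<zero>\<^bsub>M\<^esub>" "k \<in> carrier M" if "k \<in> Ke M P" for k
          using prod c that by (auto simp: An_iff colon_def)
        moreover have "f \<otimes>\<^bsub>E\<^esub> g \<in> End" using prod End_comp[of f g] by (simp add: An_iff)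
        ultimately show ?case unfolding An_iff by simp
      next
        case (sum s t)
        then show ?case
          using additive_subgroup.a_closed[OF ideal.axioms(1)[OF id(1)]] unfolding AP by blast
      qed
    qed
    then have "An A C M X \<subseteq> P \<or> An A C M Y \<subseteq> P"
      using id(3) ideal_An X Y AP by simp
    moreover have "Ke M P \<subseteq> Z" if "fully_invariant A C M Z" "An A C M Z \<subseteq> P" for Z
    proof -
      have "Ke M P \<subseteq> Ke M (An A C M Z)" using that(2) unfolding Ke_def by blast
      then show ?thesis using Ke_An[OF _ cogen, of Z] that(1) unfolding fully_invariant_def by simp
    qed
    ultimately show "Ke M P \<subseteq> X \<or> Ke M P \<subseteq> Y" using X Y by blast
  qed
qed

lemma prime_ideals_eq: "{P. prime_ideal E P} = An A C M ` {K. fully_coprime A C M K}"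
proof (intro equalityI subsetI)
  fix P assume "P \<in> {P. prime_ideal E P}"
  then have P: "prime_ideal E P" by simp
  then have "An A C M (Ke M P) = P"
    unfolding prime_ideal_def using An_Ke right_ideal_ideal by blast
  then show "P \<in> An A C M ` {K. fully_coprime A C M K}"
    using fully_coprime_Ke[OF P] by (metis image_eqI mem_Collect_eq)
qed (use prime_ideal_An in auto)

text \<open>An additive map vanishing on S vanishes on the generated subgroup. Thus annihilating the
  sum of a family amounts to annihilating each member, which gives an intersection of
  annihilators.\<close>

lemma An_generate:
  assumes "S \<subseteq> carrier M"
  shows "An A C M (generate (add_monoid M) S) = An A C M S"
proof (intro equalityI subsetI)
  fix f assume f: "f \<in> An A C M S"
  then have fE: "f \<in> End" by (simp add: An_iff)
  have "f k = \<zero>\<^bsub>M\<^esub>" if "k \<in> generate (add_monoid M) S" for k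
    using that
  proof (induction rule: generate.induct)
    case (inv h)
    then show ?case using f fE assms EndD(6)[OF fE, of h] by (auto simp: An_iff a_inv_def)
  next
    case (eng h1 h2)
    then show ?case
      using group.generate_in_carrier[OF M.right.M.a_group, of S] assms EndD(7)[OF fE, of h1 h2] by simp
  qed (use f fE in \<open>auto simp: An_iff EndD\<close>)
  then show "f \<in> An A C M (generate (add_monoid M) S)" using fE by (simp add: An_iff)
qed (auto simp: An_iff intro: generate.incl)

theorem Prad_CPcorad:
  "Prad E = An A C M (CPcorad A C M)" "CPcorad A C M = Ke M (Prad E)"
proof -
  let ?U = "\<Union>{K. fully_coprime A C M K}"
  have sub: "subcomodule A C M K" if "K \<in> {K. fully_coprime A C M K}" for K
    using that by (simp add: fully_coprime_def fully_invariant_def)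
  then have "?U \<subseteq> carrier M" using subcomodule_subset by blast
  then have "An A C M (CPcorad A C M) = An A C M ?U"
    unfolding CPcorad_def by (rule An_generate)
  \<comment> \<open>If there are no prime ideals, the intersection with the carrier in
    \<open>Prad\<close> yields all of E, which agrees with the annihilator of the empty
    union.\<close>
  also have "\<dots> = Prad E"
    unfolding Prad_def prime_ideals_eq by (auto simp: An_iff)
  finally show 1: "Prad E = An A C M (CPcorad A C M)" by simp
  \<comment> \<open>The self-cogenerator property is applied to the sum of all fully coprime
    subcomodules, which is itself a subcomodule by \<open>subcomodule_sum\<close>.\<close>
  show "CPcorad A C M = Ke M (Prad E)"
    unfolding 1 CPcorad_def by (rule Ke_An[OF subcomodule_sum[OF sub] cogen, symmetric])
qed

end

end

theorem proposition4p12: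
  fixes R :: "'r ring"
    and A :: "('r, 'a) module"
    and C :: "('a, 'c) coring"
    and M :: "('a, 'm, 'c) comodule"
  assumes "cring R" and "\<one>\<^bsub>R\<^esub> \<noteq> \<zero>\<^bsub>R\<^esub>"
    and "unital_algebra R A"
    and "coring R A C" and "carrier C \<noteq> {\<zero>\<^bsub>C\<^esub>}"
    and "flat_left TYPE('a) A C"
    and "flat_left TYPE('m) A C"
    and "flat_left TYPE(('m, 'c) tens) A C"
    and "right_comodule A C M" and "carrier M \<noteq> {\<zero>\<^bsub>M\<^esub>}"
    and "intrinsically_injective A C M"
    and "self_cogenerator A C M"
    and "right_noetherian (endo_ring A C M)"
  shows "Prad (endo_ring A C M) = An A C M (CPcorad A C M) \<and>
         CPcorad A C M = Ke M (Prad (endo_ring A C M))"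
proof -
  interpret flat_comodule R A C M
    using assms by (intro flat_comodule.intro flat_comodule_axioms.intro)
  show ?thesis using Prad_CPcorad assms(11-13) by blast
qed

end
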